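(* Let $T\in\mathbb{C}[\mathbf{X}]_d$ be a homogeneous polynomial of degree $d$ in $\mathbf{X}=(X_1,\dots,X_m)$ with a decomposition $T=\sum_{i=1}^r\omega_i\,(\xi_i\cdot\mathbf{X})^d$, where $\omega_i\in\mathbb{C}$ and $\xi_i=(\xi_{i,1},\dots,\xi_{i,m})\in\mathbb{C}^m$, such that $\operatorname{rank}H_T^{k,d-k}=r$ for some integer $k$ with $\iota(\xi_1,\dots,\xi_r)+1\le k\le d$. Let $U=(U_{\alpha,j})_{|\alpha|=k,\,1\le j\le r}\in\mathbb{C}^{s_k\times r}$ be a matrix such that $\operatorname{im}U=\operatorname{im}H_T^{k,d-k}$, and for $i\in\{1,\dots,m\}$ let $U_i=(U_{e_i+\alpha,j})_{|\alpha|=k-1,\,1\le j\le r}\in\mathbb{C}^{s_{k-1}\times r}$ be the submatrix of $U$ of the rows indexed by the monomials of degree $k$ divisible by $X_i$. Then $T$ is identifiable of rank $r$, and there exist invertible matrices $E\in\mathbb{C}^{s_{k-1}\times s_{k-1}}$, $F\in\mathbb{C}^{r\times r}$ such that $$E^{t}\,U_i\,F=\begin{bmatrix}\Delta_i\\0\end{bmatrix}\qquad\text{with }\Delta_i=\operatorname{diag}(\bar\xi_{1,i},\dots,\bar\xi_{r,i}),\quad i\in\{1,\dots,m\}.$$ Moreover, for any pair $(E,F)$ of invertible matrices (of these sizes) which diagonalises simultaneously $[U_1,\dots,U_m]$, i.e. such that for every $i\in\{1,\dots,m\}$ one has $E^tU_iF=\begin{bmatrix}\Delta_i\\0\end{bmatrix}$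 for some diagonal matrix $\Delta_i\in\mathbb{C}^{r\times r}$, there exist unique $\omega'_1,\dots,\omega'_r\in\mathbb{C}$ such that $T=\sum_{i=1}^r\omega'_i\,(\xi'_i\cdot\mathbf{X})^d$, where $\xi'_i\in\mathbb{C}^m$ is defined by $\bar\xi'_i=\big((\Delta_1)_{i,i},\dots,(\Delta_m)_{i,i}\big)$ for $i\in\{1,\dots,r\}$.
   Context: $\mathbb{C}[\mathbf{X}]_d$ is the space of homogeneous polynomials of degree $d$ in $\mathbf{X}=(X_1,\dots,X_m)$, identified with symmetric tensors of order $d$; $s_k=\binom{m+k-1}{k}=\dim\mathbb{C}[\mathbf{X}]_k$. For $\alpha\in\mathbb{N}^m$, $|\alpha|=\alpha_1+\cdots+\alpha_m$, $\mathbf{X}^\alpha=X_1^{\alpha_1}\cdots X_m^{\alpha_m}$, $\binom{d}{\alpha}=\frac{d!}{\alpha_1!\cdots\alpha_m!}$, and $e_i$ is the $i$-th canonical basis vector of $\mathbb{N}^m$. For $\xi\in\mathbb{C}^m$, $(\xi\cdot\mathbf{X})=\sum_j\xi_jX_j$ (no conjugation); a bar denotes (coordinatewise) complex conjugation, and $E^t$ is the transpose of $E$. Apolar product: for $p=\sum_{|\alpha|=d}\binom{d}{\alpha}p_\alpha\mathbf{X}^\alpha$ and $q=\sum_{|\alpha|=d}\binom{d}{\alpha}q_\alpha\mathbf{X}^\alpha$ in $\mathbb{C}[\mathbf{X}]_d$, $\langle p,q\rangle_d=\sum_{|\alpha|=d}\binom{d}{\alpha}\bar p_\alpha q_\alpha$.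 Hankel operator: for $T\in\mathbb{C}[\mathbf{X}]_d$ and $k\le d$, $H_T^{k,d-k}:\mathbb{C}[\mathbf{X}]_{d-k}\to\mathbb{C}^{s_k}$, $p\mapsto[\langle T,\mathbf{X}^\alpha p\rangle_d]_{|\alpha|=k}$; its matrix in the monomial basis is $(\langle T,\mathbf{X}^{\alpha+\beta}\rangle_d)_{|\alpha|=k,|\beta|=d-k}$. Interpolation degree: for $\Xi=\{\xi_1,\dots,\xi_r\}\subset\mathbb{C}^m$, $\iota(\Xi)=\iota(\xi_1,\dots,\xi_r)$ is the smallest degree $k$ for which there exists a family of homogeneous interpolation polynomials $u_1,\dots,u_r\in\mathbb{C}[\mathbf{X}]_k$ at the points $\Xi$, i.e. $u_i(\xi_j)=\delta_{i,j}$ for all $i,j\in\{1,\dots,r\}$ (it is implicit that such a family exists in some degree). A decomposition of $T\in\mathbb{C}[\mathbf{X}]_d$ is an expression $T=\sum_{i=1}^{s}\omega_i(\xi_i\cdot\mathbf{X})^d$ with $\omega_i\in\mathbb{C}$, $\xi_i\in\mathbb{C}^m$. The rank of $T$ is the minimal number $s$ of terms in such a decomposition, and a decomposition with the minimal number of terms is called a rank (or Waring) decomposition. $T$ is identifiable if its Waring decomposition is unique in the sense that the lines spanned by $\xi_1,\dots,\xi_s$ form a unique set of lines with no repetition (i.e. the $s$ lines $\mathbb{C}\xi_i$ are pairwise distinct, and every Waring decomposition of $T$ gives the same set of lines). *)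

theory Defs
  imports "HOL-Library.Poly_Mapping" "Jordan_Normal_Form.DL_Rank"
begin

text \<open>
  \<open>\<complex>[X\<^sub>0, \<dots>, X\<^sub>m\<^sub>-\<^sub>1]\<close> is the monoid algebra of finitely supported exponent vectors; all indices
  (variables, points, rows, columns) start at \<open>0\<close>.  Points of \<open>\<complex>\<^sup>m\<close> are elements of
  \<open>carrier_vec m\<close>.
\<close>

type_synonym expo = "nat \<Rightarrow>\<^sub>0 nat"
type_synonym cpoly = "expo \<Rightarrow>\<^sub>0 complex"

definition monomials :: "nat \<Rightarrow> nat \<Rightarrow> expo set" where
  "monomials m k = {\<alpha>. Poly_Mapping.keys \<alpha> \<subseteq> {..<m} \<and> (\<Sum>i<m. Poly_Mapping.lookup \<alpha> i) = k}"

definition homog :: "nat \<Rightarrow> nat \<Rightarrow> cpoly set" where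
  "homog m d = {p. Poly_Mapping.keys p \<subseteq> monomials m d}"

definition num_monomials :: "nat \<Rightarrow> nat \<Rightarrow> nat" where
  "num_monomials m k = (m + k - 1) choose k"

text \<open>
  Matrices whose rows or columns are indexed by the monomials of degree \<open>k\<close> are represented
  through the enumeration \<open>mon m k 0, mon m k 1, \<dots>\<close> of these monomials in increasing order
  (for the lexicographic order of \<^typ>\<open>expo\<close>); \<open>mon_index m k\<close> is its inverse.
\<close>

definition mon :: "nat \<Rightarrow> nat \<Rightarrow> nat \<Rightarrow> expo" where
  "mon m k a = sorted_list_of_set (monomials m k) ! a"

lemma finite_card_monomials:
  "finite (monomials m k) \<and> card (monomials m k) = num_monomials m k"
proof -
  let ?L = "{l::nat list. size l = m \<and> sum_list l = k}"
  let ?f = "\<lambda>\<alpha>. map (Poly_Mapping.lookup \<alpha>) [0..<m]"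
  have "inj_on ?f (monomials m k)"
  proof (rule inj_onI)
    fix \<alpha> \<beta> assume a: "\<alpha> \<in> monomials m k" and b: "\<beta> \<in> monomials m k" and e: "?f \<alpha> = ?f \<beta>"
    show "\<alpha> = \<beta>"
    proof (rule poly_mapping_eqI)
      fix i
      show "Poly_Mapping.lookup \<alpha> i = Poly_Mapping.lookup \<beta> i"
      proof (cases "i < m")
        case True
        then show ?thesis using e by simp
      next
        case False
        then have "i \<notin> Poly_Mapping.keys \<alpha>" "i \<notin> Poly_Mapping.keys \<beta>"
          using a b by (auto simp: monomials_def)
        then show ?thesis by (simp add: in_keys_iff)
      qed
    qed
  qed
  moreover have "?f ` monomials m k = ?L"
  proof (intro equalityI subsetI)
    fix l assume "l \<in> ?f ` monomials m k"
    then show "l \<in> ?L"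
      by (auto simp: monomials_def interv_sum_list_conv_sum_set_nat atLeast0LessThan)
  next
    fix l assume l: "l \<in> ?L"
    define \<alpha> where "\<alpha> = Abs_poly_mapping (\<lambda>i. if i < m then l ! i else 0)"
    have fin: "finite {i. (if i < m then l ! i else 0) \<noteq> 0}"
      by (rule finite_subset[of _ "{..<m}"]) auto
    have look: "Poly_Mapping.lookup \<alpha> = (\<lambda>i. if i < m then l ! i else 0)"
      unfolding \<alpha>_def using fin by (intro Abs_poly_mapping_inverse) simp
    have "?f \<alpha> = l"
      using l by (auto intro!: nth_equalityI simp: look)
    moreover have "\<alpha> \<in> monomials m k"
      using l by (auto simp: monomials_def look in_keys_iff sum_list_sum_nth atLeast0LessThan
          split: if_splits)
    ultimately show "l \<in> ?f ` monomials m k" by force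
  qed
  ultimately have bij: "bij_betw ?f (monomials m k) ?L" by (simp add: bij_betw_def)
  have "?L \<subseteq> {l. set l \<subseteq> {..k} \<and> length l = m}"
    using member_le_sum_list by fastforce
  then have "finite ?L" by (rule finite_subset) (simp add: finite_lists_length_eq)
  then show ?thesis
    using bij_betw_finite[OF bij] bij_betw_same_card[OF bij] card_length_sum_list[of m k]
    by (simp add: num_monomials_def add.commute)
qed

lemma bij_betw_mon: "bij_betw (mon m k) {..<num_monomials m k} (monomials m k)"
  unfolding mon_def
  using bij_betw_nth[of "sorted_list_of_set (monomials m k)"] finite_card_monomials[of m k]
  by auto

definition mon_index :: "nat \<Rightarrow> nat \<Rightarrow> expo \<Rightarrow> nat" where
  "mon_index m k = the_inv_into {..<num_monomials m k} (mon m k)"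

definition monom_poly :: "expo \<Rightarrow> cpoly" where
  "monom_poly \<alpha> = Poly_Mapping.single \<alpha> 1"

definition const_poly :: "complex \<Rightarrow> cpoly" where
  "const_poly c = Poly_Mapping.single 0 c"

definition eval_poly :: "nat \<Rightarrow> cpoly \<Rightarrow> complex vec \<Rightarrow> complex" where
  "eval_poly m p x = (\<Sum>\<alpha>\<in>Poly_Mapping.keys p. Poly_Mapping.lookup p \<alpha> * (\<Prod>i<m. (x $ i) ^ Poly_Mapping.lookup \<alpha> i))"

definition lin_form :: "nat \<Rightarrow> complex vec \<Rightarrow> cpoly" where
  "lin_form m \<xi> = (\<Sum>j<m. const_poly (\<xi> $ j) * monom_poly (Poly_Mapping.single j 1))"

definition multinom :: "nat \<Rightarrow> nat \<Rightarrow> expo \<Rightarrow> complex" where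
  "multinom m d \<alpha> = fact d / (\<Prod>i<m. fact (Poly_Mapping.lookup \<alpha> i))"

text \<open>
  The \<open>p\<^sub>\<alpha>\<close> in \<open>p = \<Sum> (d choose \<alpha>) p\<^sub>\<alpha> X\<^sup>\<alpha>\<close>, that is, the ordinary coefficient divided by the
  multinomial coefficient.
\<close>

definition scaled_coeff :: "nat \<Rightarrow> nat \<Rightarrow> cpoly \<Rightarrow> expo \<Rightarrow> complex" where
  "scaled_coeff m d p \<alpha> = Poly_Mapping.lookup p \<alpha> / multinom m d \<alpha>"

definition apolar :: "nat \<Rightarrow> nat \<Rightarrow> cpoly \<Rightarrow> cpoly \<Rightarrow> complex" where
  "apolar m d p q =
     (\<Sum>\<alpha>\<in>monomials m d. multinom m d \<alpha> * cnj (scaled_coeff m d p \<alpha>) * scaled_coeff m d q \<alpha>)"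

definition hankel :: "nat \<Rightarrow> nat \<Rightarrow> nat \<Rightarrow> cpoly \<Rightarrow> cpoly \<Rightarrow> complex vec" where
  "hankel m d k T p =
     vec (num_monomials m k) (\<lambda>a. apolar m d T (monom_poly (mon m k a) * p))"

definition hankel_mat :: "nat \<Rightarrow> nat \<Rightarrow> nat \<Rightarrow> cpoly \<Rightarrow> complex mat" where
  "hankel_mat m d k T =
     mat (num_monomials m k) (num_monomials m (d - k))
       (\<lambda>(a, b). apolar m d T (monom_poly (mon m k a + mon m (d - k) b)))"

lemma hankel_eq_hankel_mat:
  assumes "p \<in> homog m (d - k)"
  shows "hankel m d k T p =
    hankel_mat m d k T *\<^sub>v
      vec (num_monomials m (d - k)) (\<lambda>b. Poly_Mapping.lookup p (mon m (d - k) b))"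
proof -
  let ?M = "monomials m (d - k)" and ?n = "num_monomials m (d - k)"
  have fin: "finite ?M" by (simp add: finite_card_monomials)
  have p: "p = (\<Sum>\<beta>\<in>?M. Poly_Mapping.single \<beta> (Poly_Mapping.lookup p \<beta>))"
  proof (rule poly_mapping_eqI)
    fix \<gamma>
    have "Poly_Mapping.lookup p \<gamma> = 0" if "\<gamma> \<notin> ?M"
      using assms that by (auto simp: homog_def in_keys_iff)
    then show "Poly_Mapping.lookup p \<gamma> =
        Poly_Mapping.lookup (\<Sum>\<beta>\<in>?M. Poly_Mapping.single \<beta> (Poly_Mapping.lookup p \<beta>)) \<gamma>"
      using fin by (auto simp: lookup_sum lookup_single when_def sum.delta)
  qed
  have key: "apolar m d T (monom_poly \<alpha> * p) =
      (\<Sum>b<?n. apolar m d T (monom_poly (\<alpha> + mon m (d - k) b))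
                 * Poly_Mapping.lookup p (mon m (d - k) b))" for \<alpha>
  proof -
    have "monom_poly \<alpha> * p =
        (\<Sum>\<beta>\<in>?M. Poly_Mapping.single (\<alpha> + \<beta>) (Poly_Mapping.lookup p \<beta>))"
      by (subst p) (simp add: sum_distrib_left monom_poly_def mult_single)
    then have "Poly_Mapping.lookup (monom_poly \<alpha> * p) \<gamma> =
        (\<Sum>\<beta>\<in>?M. Poly_Mapping.lookup (monom_poly (\<alpha> + \<beta>)) \<gamma> * Poly_Mapping.lookup p \<beta>)" for \<gamma>
      by (auto simp: lookup_sum monom_poly_def lookup_single when_def intro!: sum.cong)
    then have "apolar m d T (monom_poly \<alpha> * p) =
        (\<Sum>\<gamma>\<in>monomials m d. \<Sum>\<beta>\<in>?M. multinom m d \<gamma> * cnj (scaled_coeff m d T \<gamma>) *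
           scaled_coeff m d (monom_poly (\<alpha> + \<beta>)) \<gamma> * Poly_Mapping.lookup p \<beta>)"
      unfolding apolar_def
      by (auto simp: scaled_coeff_def divide_inverse sum_distrib_left sum_distrib_right mult_ac
          intro!: sum.cong)
    also have "\<dots> = (\<Sum>\<beta>\<in>?M. apolar m d T (monom_poly (\<alpha> + \<beta>)) * Poly_Mapping.lookup p \<beta>)"
      by (subst sum.swap) (simp add: apolar_def sum_distrib_right)
    also have "\<dots> = (\<Sum>b<?n. apolar m d T (monom_poly (\<alpha> + mon m (d - k) b))
                 * Poly_Mapping.lookup p (mon m (d - k) b))"
      by (rule sum.reindex_bij_betw[OF bij_betw_mon, symmetric])
    finally show ?thesis .
  qed
  show ?thesis
    by (rule eq_vecI)
      (auto simp: hankel_def hankel_mat_def key scalar_prod_def atLeast0LessThan intro!: sum.cong)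
qed

definition hankel_rank :: "nat \<Rightarrow> nat \<Rightarrow> nat \<Rightarrow> cpoly \<Rightarrow> nat" where
  "hankel_rank m d k T = vec_space.rank (num_monomials m k) (hankel_mat m d k T)"

definition interp_family ::
  "nat \<Rightarrow> nat \<Rightarrow> nat \<Rightarrow> (nat \<Rightarrow> complex vec) \<Rightarrow> (nat \<Rightarrow> cpoly) \<Rightarrow> bool" where
  "interp_family m k r \<xi> u \<longleftrightarrow>
     (\<forall>i<r. u i \<in> homog m k \<and> (\<forall>j<r. eval_poly m (u i) (\<xi> j) = (if i = j then 1 else 0)))"

text \<open>Only meaningful if an interpolation family exists in some degree.\<close>

definition interp_degree :: "nat \<Rightarrow> nat \<Rightarrow> (nat \<Rightarrow> complex vec) \<Rightarrow> nat" where
  "interp_degree m r \<xi> = (LEAST k. \<exists>u. interp_family m k r \<xi> u)"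

definition is_decomp ::
  "nat \<Rightarrow> nat \<Rightarrow> cpoly \<Rightarrow> nat \<Rightarrow> (nat \<Rightarrow> complex) \<Rightarrow> (nat \<Rightarrow> complex vec) \<Rightarrow> bool" where
  "is_decomp m d T s \<omega> \<xi> \<longleftrightarrow>
     (\<forall>i<s. \<xi> i \<in> carrier_vec m) \<and>
     T = (\<Sum>i<s. const_poly (\<omega> i) * lin_form m (\<xi> i) ^ d)"

definition waring_rank :: "nat \<Rightarrow> nat \<Rightarrow> cpoly \<Rightarrow> nat" where
  "waring_rank m d T = (LEAST s. \<exists>\<omega> \<xi>. is_decomp m d T s \<omega> \<xi>)"

definition waring_decomp ::
  "nat \<Rightarrow> nat \<Rightarrow> cpoly \<Rightarrow> (nat \<Rightarrow> complex) \<Rightarrow> (nat \<Rightarrow> complex vec) \<Rightarrow> bool" where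
  "waring_decomp m d T \<omega> \<xi> \<longleftrightarrow> is_decomp m d T (waring_rank m d T) \<omega> \<xi>"

definition line :: "complex vec \<Rightarrow> complex vec set" where
  "line v = {c \<cdot>\<^sub>v v | c. True}"

definition identifiable :: "nat \<Rightarrow> nat \<Rightarrow> cpoly \<Rightarrow> bool" where
  "identifiable m d T \<longleftrightarrow>
     (\<exists>\<omega> \<xi>. waring_decomp m d T \<omega> \<xi>) \<and>
     (\<forall>\<omega> \<xi>. waring_decomp m d T \<omega> \<xi> \<longrightarrow> inj_on (\<lambda>i. line (\<xi> i)) {..<waring_rank m d T}) \<and>
     (\<forall>\<omega> \<xi> \<omega>' \<xi>'. waring_decomp m d T \<omega> \<xi> \<longrightarrow> waring_decomp m d T \<omega>' \<xi>' \<longrightarrow>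
        (\<lambda>i. line (\<xi> i)) ` {..<waring_rank m d T} = (\<lambda>i. line (\<xi>' i)) ` {..<waring_rank m d T})"

text \<open>The rows of \<open>U\<close> indexed by the monomials \<open>e\<^sub>i + \<alpha>\<close> with \<open>\<alpha>\<close> of degree \<open>k - 1\<close>.\<close>

definition shift_submat :: "nat \<Rightarrow> nat \<Rightarrow> complex mat \<Rightarrow> nat \<Rightarrow> complex mat" where
  "shift_submat m k U i =
     mat (num_monomials m (k - 1)) (dim_col U)
       (\<lambda>(a, j). U $$ (mon_index m k (Poly_Mapping.single i 1 + mon m (k - 1) a), j))"

text \<open>\<open>D\<close> on top of a zero block, with \<open>n\<close> rows in total (for \<open>D\<close> with at most \<open>n\<close> rows).\<close>

definition pad_rows :: "nat \<Rightarrow> complex mat \<Rightarrow> complex mat" where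
  "pad_rows n D = D @\<^sub>r 0\<^sub>m (n - dim_row D) (dim_col D)"

end

theory Submission
  imports Defs
begin

text \<open>
  Write \<open>v\<^sub>k(x)\<close> for the vector of all monomials of degree \<open>k\<close> at a point \<open>x\<close>, let \<open>x\<^sub>j\<close> be the
  conjugate of \<open>\<xi>\<^sub>j\<close>, and let \<open>V\<^sub>k\<close> be the matrix with columns \<open>v\<^sub>k(x\<^sub>1), \<dots>, v\<^sub>k(x\<^sub>r)\<close>.  By the
  multinomial theorem, a decomposition of \<open>T\<close> writes its scaled coefficients as moments
  \<open>\<Sum>\<^sub>j \<omega>\<^sub>j \<xi>\<^sub>j\<^sup>\<alpha>\<close> (\<open>is_decomp_iff_moments\<close>), so the Hankel matrix factors as \<open>V\<^sub>k\<close> times a matrix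
  with \<open>r\<close> rows.  If its rank is \<open>r\<close>, then \<open>V\<^sub>k\<close> is injective and has the same image as the Hankel
  operator (\<open>full_hankel_rank\<close>).  This applies to every decomposition of length \<open>r\<close>.  It also rules
  out shorter ones: padded with zero vectors, they would yield a zero column of \<open>V\<^sub>k\<close>.

  The interpolation degree is at most \<open>k - 1\<close>, and all points are nonzero; therefore \<open>V\<^sub>k\<^sub>-\<^sub>1\<close> is
  injective as well (\<open>separates_mono\<close>).  The heart of the proof is \<open>matching_points\<close>: suppose that
  some combination \<open>\<Sum>\<^sub>l B\<^sub>l\<^sub>j x\<^sub>l\<^sub>,\<^sub>i v\<^sub>k\<^sub>-\<^sub>1(x\<^sub>l)\<close> equals, for every coordinate \<open>i\<close>, the multiple
  \<open>y\<^sub>j\<^sub>,\<^sub>i w\<^sub>j\<close> of a vector that does not depend on \<open>i\<close>.  Then \<open>x\<^sub>l\<close> and \<open>y\<^sub>j\<close> are proportional whenever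
  \<open>B\<^sub>l\<^sub>j \<noteq> 0\<close>; if \<open>B\<close> has no zero row, the \<open>y\<^sub>j\<close> are the \<open>x\<^sub>l\<close> up to order and scaling.  It is used twice.

  For identifiability, let \<open>y\<^sub>j\<close> be the conjugate points of another decomposition of length \<open>r\<close>.
  Both have the same image in degree \<open>k\<close>, so \<open>v\<^sub>k(y\<^sub>j) = \<Sum>\<^sub>l B\<^sub>l\<^sub>j v\<^sub>k(x\<^sub>l)\<close> with \<open>B\<close> invertible; the
  rows divisible by \<open>X\<^sub>i\<close> give the equations above with \<open>w\<^sub>j = v\<^sub>k\<^sub>-\<^sub>1(y\<^sub>j)\<close>.

  For the matrices, \<open>U = V\<^sub>k G\<close> with \<open>G\<close> invertible, so \<open>U\<^sub>i = V\<^sub>k\<^sub>-\<^sub>1 D\<^sub>i G\<close> where \<open>D\<^sub>i\<close> is the diagonal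
  matrix of the \<open>i\<close>-th coordinates of the \<open>x\<^sub>j\<close>.  A completion of the columns of \<open>V\<^sub>k\<^sub>-\<^sub>1\<close> to a basis
  yields \<open>E\<close>, and \<open>F\<close> is the inverse of \<open>G\<close>.  Conversely, for any diagonalising pair the
  columns of \<open>V\<^sub>k\<^sub>-\<^sub>1 D\<^sub>i G F\<close> are multiples of columns of the inverse of \<open>E\<^sup>T\<close>, which is again the
  situation of \<open>matching_points\<close>, now with the diagonal entries as coordinates of the \<open>y\<^sub>j\<close>.  The
  recovered points are nonzero multiples of the \<open>\<xi>\<^sub>l\<close>, and the weights follow, uniquely because the
  \<open>d\<close>-th powers at the \<open>\<xi>\<^sub>l\<close> are independent.
\<close>

section \<open>Injective matrices\<close>

definition injective_mat :: "complex mat \<Rightarrow> bool" where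
  "injective_mat A \<longleftrightarrow>
     (\<forall>v\<in>carrier_vec (dim_col A). A *\<^sub>v v = 0\<^sub>v (dim_row A) \<longrightarrow> v = 0\<^sub>v (dim_col A))"

lemma mult_unit_vec_col:
  fixes A :: "complex mat"
  assumes "A \<in> carrier_mat n r" "j < r"
  shows "A *\<^sub>v unit_vec r j = col A j"
  by (rule eq_vecI) (use assms in \<open>auto simp: scalar_prod_right_unit\<close>)

lemma mult_zero_vec:
  fixes A :: "complex mat"
  assumes "A \<in> carrier_mat n r"
  shows "A *\<^sub>v 0\<^sub>v r = 0\<^sub>v n"
  by (rule eq_vecI) (use assms in \<open>auto simp: scalar_prod_def\<close>)

lemma injective_mat_cancel:
  assumes "injective_mat A" "A \<in> carrier_mat n r" "X \<in> carrier_mat r q" "Y \<in> carrier_mat r q"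
    and eq: "A * X = A * Y"
  shows "X = Y"
proof (rule eq_matI)
  fix i j assume ij: "i < dim_row Y" "j < dim_col Y"
  have c: "col X j \<in> carrier_vec r" "col Y j \<in> carrier_vec r" using assms by auto
  have "A *\<^sub>v col X j = A *\<^sub>v col Y j"
    using arg_cong[OF eq, of "\<lambda>M. col M j"] col_mult2[OF assms(2,3), of j]
      col_mult2[OF assms(2,4), of j] assms(4) ij by simp
  then have "A *\<^sub>v (col X j - col Y j) = 0\<^sub>v n"
    using mult_minus_distrib_mat_vec[OF assms(2) c] assms(2) c by auto
  then have "col X j - col Y j = 0\<^sub>v r"
    using assms(1,2) c unfolding injective_mat_def by auto
  then have "(col X j - col Y j) $ i = 0" using assms ij by auto
  then show "X $$ (i, j) = Y $$ (i, j)" using assms ij c by auto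
qed (use assms in auto)

lemma injective_mat_distinct_cols:
  assumes "injective_mat A" "A \<in> carrier_mat n r"
  shows "distinct (cols A)"
proof (rule ccontr)
  assume "\<not> distinct (cols A)"
  then obtain i j where ij: "i < r" "j < r" "i \<noteq> j" "col A i = col A j"
    using assms(2) by (auto simp: distinct_conv_nth)
  have "A *\<^sub>v unit_vec r i = A *\<^sub>v unit_vec r j"
    using ij assms(2) by (simp add: mult_unit_vec_col)
  then have "A *\<^sub>v (unit_vec r i - unit_vec r j) = 0\<^sub>v n"
    using mult_minus_distrib_mat_vec[OF assms(2), of "unit_vec r i" "unit_vec r j"] assms(2) by auto
  then have "unit_vec r i - unit_vec r j = (0\<^sub>v r :: complex vec)"
    using assms unfolding injective_mat_def by auto
  then have "(unit_vec r i - unit_vec r j :: complex vec) $ i = 0" using ij by simp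
  then show False using ij by simp
qed

lemma lin_indpt_cols_iff_injective_mat:
  assumes "A \<in> carrier_mat n r" "distinct (cols A)"
  shows "\<not> module.lin_dep class_ring (module_vec TYPE(complex) n) (set (cols A)) \<longleftrightarrow> injective_mat A"
proof -
  interpret vec_space "TYPE(complex)" n .
  show ?thesis
    using assms lin_depI[OF assms(1) _ _ _ assms(2)] lin_depE[OF assms(1) _ assms(2)]
    unfolding injective_mat_def by (metis carrier_matD)
qed

lemma injective_square_mat_inverse:
  assumes "A \<in> carrier_mat n n" "injective_mat A"
  obtains B where "B \<in> carrier_mat n n" "A * B = 1\<^sub>m n" "B * A = 1\<^sub>m n"
proof -
  have "det A \<noteq> 0"
    using det_0_iff_vec_prod_zero_field[OF assms(1)] assms unfolding injective_mat_def by auto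
  from det_non_zero_imp_unit[OF assms(1) this, of "()"] that
  show ?thesis by (auto simp: Units_def ring_mat_def)
qed

text \<open>
  The product \<open>A * W\<close> has \<open>r\<close> independent columns, and these form \<open>A * (W * C)\<close> for a selection
  of columns \<open>W * C\<close>.  That square matrix has trivial kernel because already \<open>A * (W * C)\<close> has,
  so it can be inverted: \<open>A\<close> is itself the injective matrix \<open>A * W * C\<close> times an invertible one.
\<close>

lemma full_rank_product:
  assumes A: "A \<in> carrier_mat n r" and W: "W \<in> carrier_mat r q"
    and rank: "vec_space.rank n (A * W) = r"
  shows "injective_mat A"
    and "v \<in> carrier_vec r \<Longrightarrow> \<exists>w\<in>carrier_vec q. A * W *\<^sub>v w = A *\<^sub>v v"
proof -
  interpret vec_space "TYPE(complex)" n .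
  let ?H = "A * W"
  have H: "?H \<in> carrier_mat n q" using A W by simp
  obtain S where S: "maximal S (\<lambda>T. T \<subseteq> set (cols ?H) \<and> lin_indpt T)"
    using maximal_exists[of "(\<lambda>T. T \<subseteq> set (cols ?H) \<and> lin_indpt T)" "card (set (cols ?H))" "{}"]
    by (meson List.finite_set card_mono empty_iff empty_subsetI finite_lin_indpt2 rev_finite_subset)
  then have Sc: "S \<subseteq> set (cols ?H)" and Si: "lin_indpt S" by (auto simp: maximal_def)
  have card: "card S = r" using rank_card_indpt[OF H S] rank by simp
  obtain xs where xs: "set xs = S" "distinct xs"
    using finite_distinct_list[OF finite_subset[OF Sc]] by auto
  have len: "length xs = r" using xs card distinct_card by fastforce
  have xsc: "set xs \<subseteq> carrier_vec n" using Sc xs cols_dim[of ?H] A by auto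
  have "\<forall>j<r. \<exists>w. w \<in> carrier_vec q \<and> xs ! j = ?H *\<^sub>v w"
  proof (intro allI impI)
    fix j assume "j < r"
    then have "xs ! j \<in> set (cols ?H)" using len xs Sc by auto
    then obtain c where "c < q" "xs ! j = col ?H c" using H by (auto simp: in_set_conv_nth)
    then have "xs ! j = ?H *\<^sub>v unit_vec q c" using H by (simp add: mult_unit_vec_col)
    then show "\<exists>w. w \<in> carrier_vec q \<and> xs ! j = ?H *\<^sub>v w" by (meson unit_vec_carrier)
  qed
  then obtain f where f: "\<And>j. j < r \<Longrightarrow> f j \<in> carrier_vec q"
      "\<And>j. j < r \<Longrightarrow> xs ! j = ?H *\<^sub>v f j" by metis
  \<comment> \<open>\<open>C\<close> selects the columns: \<open>A * W * C\<close> consists of the \<open>r\<close> independent ones.\<close>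
  define C where "C = mat_of_cols q (map f [0..<r])"
  have C: "C \<in> carrier_mat q r" and colC: "\<And>j. j < r \<Longrightarrow> col C j = f j"
    unfolding C_def using f by auto
  have HC: "?H * C = mat_of_cols n xs"
  proof (rule mat_col_eqI)
    fix j assume "j < dim_col (mat_of_cols n xs)"
    then have j: "j < r" "xs ! j \<in> carrier_vec n" using len xsc by auto
    then have "col (mat_of_cols n xs) j = xs ! j" using len by simp
    then show "col (?H * C) j = col (mat_of_cols n xs) j"
      using j f colC col_mult2[OF H C] by simp
  qed (use A C len in auto)
  have inj_HC: "injective_mat (?H * C)"
    using lin_indpt_cols_iff_injective_mat[of "mat_of_cols n xs" n r] mat_of_cols_carrier(1)[of n xs]
      xs xsc Si len unfolding HC by simp
  have W': "W * C \<in> carrier_mat r r" using W C by simp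
  have "injective_mat (W * C)"
    unfolding injective_mat_def
  proof (intro ballI impI)
    fix v assume v: "v \<in> carrier_vec (dim_col (W * C))" and z: "W * C *\<^sub>v v = 0\<^sub>v (dim_row (W * C))"
    have "?H * C *\<^sub>v v = A *\<^sub>v (W * C *\<^sub>v v)"
      using assoc_mult_mat[OF A W C] assoc_mult_mat_vec[OF A W', of v] v C by simp
    also have "\<dots> = 0\<^sub>v n" using z A W by auto
    finally show "v = 0\<^sub>v (dim_col (W * C))"
      using inj_HC v A C W unfolding injective_mat_def by auto
  qed
  from injective_square_mat_inverse[OF W' this] obtain Y where
    Y: "Y \<in> carrier_mat r r" "W * C * Y = 1\<^sub>m r" "Y * (W * C) = 1\<^sub>m r" by metis
  have AHC: "A = ?H * C * Y"
  proof -
    have "A = A * (W * C * Y)" using Y A by simp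
    also have "\<dots> = A * (W * C) * Y" using assoc_mult_mat[OF A W' Y(1)] by simp
    also have "\<dots> = ?H * C * Y" using assoc_mult_mat[OF A W C] by simp
    finally show ?thesis .
  qed
  show "injective_mat A"
    unfolding injective_mat_def
  proof (intro ballI impI)
    fix v assume v: "v \<in> carrier_vec (dim_col A)" and z: "A *\<^sub>v v = 0\<^sub>v (dim_row A)"
    have v': "v \<in> carrier_vec r" using v A by auto
    have "?H * C *\<^sub>v (Y *\<^sub>v v) = A *\<^sub>v v"
      by (subst (2) AHC, subst assoc_mult_mat_vec[of _ n r]) (use H C Y v' in auto)
    then have "Y *\<^sub>v v = 0\<^sub>v r"
      using inj_HC H C Y v' z A unfolding injective_mat_def by auto
    then have "W * C *\<^sub>v (Y *\<^sub>v v) = 0\<^sub>v r" using mult_zero_vec[OF W'] by simp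
    then have "1\<^sub>m r *\<^sub>v v = 0\<^sub>v r"
      using assoc_mult_mat_vec[OF W' Y(1) v'] Y by simp
    then show "v = 0\<^sub>v (dim_col A)" using v' A by simp
  qed
  show "\<exists>w\<in>carrier_vec q. ?H *\<^sub>v w = A *\<^sub>v v" if v: "v \<in> carrier_vec r"
  proof
    show "C *\<^sub>v (Y *\<^sub>v v) \<in> carrier_vec q" using C Y v by auto
    show "?H *\<^sub>v (C *\<^sub>v (Y *\<^sub>v v)) = A *\<^sub>v v"
      by (subst (2) AHC, subst assoc_mult_mat_vec[of _ n r _ r])
        (use H C Y v in \<open>auto simp: assoc_mult_mat_vec[of _ n q _ r]\<close>)
  qed
qed

lemma pad_rows_carrier [simp]:
  assumes "D \<in> carrier_mat r q" "r \<le> n"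
  shows "pad_rows n D \<in> carrier_mat n q"
  using assms carrier_append_rows[of D r q "0\<^sub>m (n - r) q" "n - r"] unfolding pad_rows_def by auto

lemma pad_rows_index:
  assumes "D \<in> carrier_mat r q" "r \<le> n" "a < n" "j < q"
  shows "pad_rows n D $$ (a, j) = (if a < r then D $$ (a, j) else 0)"
  using assms unfolding pad_rows_def append_rows_def
  by (subst index_mat_four_block) auto

text \<open>
  The \<open>r\<close> independent columns of \<open>V\<close> are completed by unit vectors to a basis of \<open>\<complex>\<^sup>n\<close>.
  The first \<open>r\<close> members of this basis are the columns of \<open>V\<close>, hence the inverse of the basis
  matrix maps them to the first \<open>r\<close> unit vectors.
\<close>

lemma injective_mat_normal_form:
  assumes V: "V \<in> carrier_mat n r" and inj: "injective_mat V"
  shows "r \<le> n"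
    and "\<exists>P Q. P \<in> carrier_mat n n \<and> Q \<in> carrier_mat n n \<and> P * Q = 1\<^sub>m n \<and> Q * P = 1\<^sub>m n
           \<and> P * V = pad_rows n (1\<^sub>m r)"
proof -
  interpret vec_space "TYPE(complex)" n .
  have dist: "distinct (cols V)" by (rule injective_mat_distinct_cols[OF inj V])
  have indep: "lin_indpt (set (cols V))"
    using lin_indpt_cols_iff_injective_mat[OF V dist] inj by simp
  have Vc: "set (cols V) \<subseteq> carrier_vec n" using V cols_dim by blast
  let ?S = "set (cols V) \<union> set (unit_vecs n)"
  obtain S where S: "maximal S (\<lambda>T. T \<subseteq> ?S \<and> lin_indpt T)" "set (cols V) \<subseteq> S" "finite S"
    using maximal_exists_superset[of ?S "(\<lambda>T. T \<subseteq> ?S \<and> lin_indpt T)" "set (cols V)"] indep by auto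
  have Sc: "?S \<subseteq> carrier_vec n" using Vc unit_vecs_carrier by auto
  have "span ?S = carrier_vec n"
    using span_is_monotone[of "set (unit_vecs n)" ?S] span_unit_vecs_is_carrier
      span_is_subset2[of ?S] Sc by auto
  then have "card S = n"
    using dim_span[OF _ _ S(1)] Sc dim_is_n by (auto simp: module_vec_def)
  have Scc: "S \<subseteq> carrier_vec n" and Si: "lin_indpt S" using S(1) Sc by (auto simp: maximal_def)
  obtain zs where zs: "set zs = S - set (cols V)" "distinct zs"
    using finite_distinct_list[of "S - set (cols V)"] S by auto
  define ys where "ys = cols V @ zs"
  have ys: "set ys = S" "distinct ys" using zs S dist unfolding ys_def by auto
  have len: "length ys = n" using distinct_card[OF ys(2)] ys \<open>card S = n\<close> by simp
  then show rn: "r \<le> n" using V unfolding ys_def by auto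
  define M where "M = mat_of_cols n ys"
  have M: "M \<in> carrier_mat n n" unfolding M_def using len by auto
  have cM: "cols M = ys" unfolding M_def using ys Scc by simp
  have "injective_mat M"
    using lin_indpt_cols_iff_injective_mat[OF M] cM ys Si by simp
  from injective_square_mat_inverse[OF M this] obtain P where
    P: "P \<in> carrier_mat n n" "M * P = 1\<^sub>m n" "P * M = 1\<^sub>m n" by metis
  have "P * V = pad_rows n (1\<^sub>m r)"
  proof (rule eq_matI)
    fix a j assume aj: "a < dim_row (pad_rows n (1\<^sub>m r))" "j < dim_col (pad_rows n (1\<^sub>m r))"
    then have a: "a < n" and j: "j < r"
      using pad_rows_carrier[of "1\<^sub>m r" r r n] rn by (auto dest: carrier_matD)
    have "col M j = col V j"
      using j rn V M cols_nth[of j M] cols_nth[of j V] unfolding cM ys_def by (simp add: nth_append)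
    then have "(P * V) $$ (a, j) = row P a \<bullet> col M j"
      using a j P V by simp
    also have "\<dots> = (P * M) $$ (a, j)"
      by (rule index_mult_mat(1)[symmetric]) (use a j rn P M in auto)
    also have "\<dots> = 1\<^sub>m n $$ (a, j)" using P by simp
    finally have "(P * V) $$ (a, j) = 1\<^sub>m n $$ (a, j)" .
    then show "(P * V) $$ (a, j) = pad_rows n (1\<^sub>m r) $$ (a, j)"
      using a j rn P by (simp add: pad_rows_index[of _ r r])
  qed (use rn V P pad_rows_carrier[of "1\<^sub>m r" r r n] in auto)
  then show "\<exists>P Q. P \<in> carrier_mat n n \<and> Q \<in> carrier_mat n n \<and> P * Q = 1\<^sub>m n \<and> Q * P = 1\<^sub>m n
           \<and> P * V = pad_rows n (1\<^sub>m r)" using P M by blast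
qed

section \<open>Monomials, powers of linear forms and moments\<close>

definition monomial_at :: "nat \<Rightarrow> complex vec \<Rightarrow> expo \<Rightarrow> complex" where
  "monomial_at m x \<alpha> = (\<Prod>i<m. (x $ i) ^ Poly_Mapping.lookup \<alpha> i)"

lemma finite_monomials [simp]: "finite (monomials m k)"
  by (simp add: finite_card_monomials)

lemma monomial_at_add: "monomial_at m x (\<alpha> + \<beta>) = monomial_at m x \<alpha> * monomial_at m x \<beta>"
  by (simp add: monomial_at_def lookup_add power_add prod.distrib)

lemma monomial_at_single:
  assumes "i < m" shows "monomial_at m x (Poly_Mapping.single i 1) = x $ i"
proof -
  have "monomial_at m x (Poly_Mapping.single i 1) = (\<Prod>j<m. if j = i then x $ i else 1)"
    unfolding monomial_at_def by (rule prod.cong) (auto simp: lookup_single when_def)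
  then show ?thesis using assms by (simp add: prod.delta)
qed

lemma monomial_at_cnj:
  assumes "x \<in> carrier_vec m"
  shows "monomial_at m (conjugate x) \<alpha> = cnj (monomial_at m x \<alpha>)"
  unfolding monomial_at_def using assms by (simp add: conjugate_vec_def)

text \<open>
  Homogeneity: moving a point along its line multiplies all monomials of degree \<open>k\<close> by the same
  factor.
\<close>

lemma monomial_at_scale:
  assumes "\<alpha> \<in> monomials m k" and "\<And>i. i < m \<Longrightarrow> y $ i = c * x $ i"
  shows "monomial_at m y \<alpha> = c ^ k * monomial_at m x \<alpha>"
proof -
  have "monomial_at m y \<alpha> = (\<Prod>i<m. c ^ Poly_Mapping.lookup \<alpha> i * (x $ i) ^ Poly_Mapping.lookup \<alpha> i)"
    unfolding monomial_at_def using assms(2) by (intro prod.cong) (auto simp: power_mult_distrib)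
  also have "\<dots> = c ^ (\<Sum>i<m. Poly_Mapping.lookup \<alpha> i) * monomial_at m x \<alpha>"
    by (simp add: prod.distrib power_sum monomial_at_def)
  finally show ?thesis using assms(1) by (simp add: monomials_def)
qed

lemma monomial_at_zero:
  assumes "\<alpha> \<in> monomials m k" "k \<ge> 1" and "\<And>i. i < m \<Longrightarrow> x $ i = 0"
  shows "monomial_at m x \<alpha> = 0"
  using monomial_at_scale[OF assms(1), of x 0 x] assms by (simp add: power_0_left split: if_splits)

lemma keys_add_nat: "Poly_Mapping.keys (\<alpha> + \<beta> :: expo) = Poly_Mapping.keys \<alpha> \<union> Poly_Mapping.keys \<beta>"
  by (auto simp: in_keys_iff lookup_add)

lemma monomials_add:
  assumes "\<alpha> \<in> monomials m k" "\<beta> \<in> monomials m l"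
  shows "\<alpha> + \<beta> \<in> monomials m (k + l)"
  using assms by (auto simp: monomials_def lookup_add sum.distrib keys_add_nat)

lemma single_add_in_monomials_iff:
  assumes "i < m"
  shows "Poly_Mapping.single i 1 + \<beta> \<in> monomials m (Suc k) \<longleftrightarrow> \<beta> \<in> monomials m k"
  using assms
  by (auto simp: monomials_def lookup_add sum.distrib keys_add_nat lookup_single when_def)

lemma mon_in_monomials: "a < num_monomials m k \<Longrightarrow> mon m k a \<in> monomials m k"
  using bij_betw_mon[of m k] by (auto simp: bij_betw_def)

lemma mon_index:
  assumes "\<alpha> \<in> monomials m k"
  shows "mon_index m k \<alpha> < num_monomials m k" "mon m k (mon_index m k \<alpha>) = \<alpha>"
proof -
  have inj: "inj_on (mon m k) {..<num_monomials m k}"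
    and img: "\<alpha> \<in> mon m k ` {..<num_monomials m k}"
    using bij_betw_mon[of m k] assms by (auto simp: bij_betw_def)
  show "mon m k (mon_index m k \<alpha>) = \<alpha>"
    unfolding mon_index_def by (rule f_the_inv_into_f[OF inj img])
  show "mon_index m k \<alpha> < num_monomials m k"
    using the_inv_into_into[OF inj img subset_refl] unfolding mon_index_def by simp
qed

text \<open>
  Multiplication by a monomial shifts the coefficients.
\<close>

lemma lookup_single_times_add:
  "Poly_Mapping.lookup (Poly_Mapping.single \<epsilon> c * p) (\<epsilon> + \<beta>) = c * Poly_Mapping.lookup (p :: cpoly) \<beta>"
  and lookup_single_times_other:
  "(\<And>\<beta>. \<alpha> \<noteq> \<epsilon> + \<beta>) \<Longrightarrow> Poly_Mapping.lookup (Poly_Mapping.single \<epsilon> c * p) \<alpha> = 0"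
proof -
  have p: "p = (\<Sum>\<beta>\<in>Poly_Mapping.keys p. Poly_Mapping.single \<beta> (Poly_Mapping.lookup p \<beta>))"
    by (rule poly_mapping_eqI)
      (auto simp: lookup_sum lookup_single when_def sum.delta in_keys_iff)
  have look: "Poly_Mapping.lookup (Poly_Mapping.single \<epsilon> c * p) \<alpha> =
      (\<Sum>\<beta>\<in>Poly_Mapping.keys p. if \<epsilon> + \<beta> = \<alpha> then c * Poly_Mapping.lookup p \<beta> else 0)" for \<alpha>
    by (subst p) (simp add: sum_distrib_left mult_single lookup_sum lookup_single when_def)
  show "Poly_Mapping.lookup (Poly_Mapping.single \<epsilon> c * p) (\<epsilon> + \<beta>) = c * Poly_Mapping.lookup p \<beta>"
    unfolding look by (simp add: sum.delta in_keys_iff)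
  show "Poly_Mapping.lookup (Poly_Mapping.single \<epsilon> c * p) \<alpha> = 0" if "\<And>\<beta>. \<alpha> \<noteq> \<epsilon> + \<beta>"
    unfolding look using that by (intro sum.neutral) metis
qed

lemma split_off_variable:
  assumes "Poly_Mapping.lookup \<alpha> i > 0"
  obtains \<beta> :: expo where "\<alpha> = Poly_Mapping.single i 1 + \<beta>"
proof
  show "\<alpha> = Poly_Mapping.single i 1 + (\<alpha> - Poly_Mapping.single i 1)"
    by (rule poly_mapping_eqI) (use assms in \<open>auto simp: lookup_add lookup_minus lookup_single when_def\<close>)
qed

text \<open>
  The recursion \<open>(\<beta>\<^sub>i + 1) (d + 1 choose \<beta> + e\<^sub>i) = (d + 1) (d choose \<beta>)\<close>, without division.
\<close>

lemma multinom_single_add: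
  assumes "i < m"
  shows "of_nat (Suc (Poly_Mapping.lookup \<beta> i)) * multinom m (Suc d) (Poly_Mapping.single i 1 + \<beta>)
    = of_nat (Suc d) * multinom m d \<beta>"
proof -
  let ?e = "Poly_Mapping.single i (1::nat)"
  have "(\<Prod>j<m. fact (Poly_Mapping.lookup (?e + \<beta>) j)) =
      (\<Prod>j<m. (if j = i then of_nat (Suc (Poly_Mapping.lookup \<beta> i)) else 1) *
         (fact (Poly_Mapping.lookup \<beta> j) :: complex))"
    by (rule prod.cong) (auto simp: lookup_add lookup_single when_def)
  also have "\<dots> = of_nat (Suc (Poly_Mapping.lookup \<beta> i)) * (\<Prod>j<m. fact (Poly_Mapping.lookup \<beta> j))"
    using assms by (simp add: prod.distrib prod.delta)
  finally have prd: "(\<Prod>j<m. fact (Poly_Mapping.lookup (?e + \<beta>) j)) =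
      of_nat (Suc (Poly_Mapping.lookup \<beta> i)) * (\<Prod>j<m. fact (Poly_Mapping.lookup \<beta> j) :: complex)" .
  have "of_nat (Suc (Poly_Mapping.lookup \<beta> i)) \<noteq> (0::complex)" by (simp only: of_nat_eq_0_iff)
  then show ?thesis
    unfolding multinom_def prd fact_Suc by (simp del: of_nat_Suc)
qed

lemma multinom_nonzero: "multinom m d \<alpha> \<noteq> 0"
  by (simp add: multinom_def)

text \<open>
  The multinomial theorem.  In the step from \<open>d\<close> to \<open>d + 1\<close> the \<open>j\<close>-th summand of the linear form
  contributes the fraction \<open>\<alpha>\<^sub>j / (d + 1)\<close> of the claimed coefficient at \<open>\<alpha>\<close>, and these
  fractions add up to \<open>1\<close>.
\<close>

lemma lookup_lin_form_power:
  "Poly_Mapping.lookup (lin_form m x ^ d) \<alpha> =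
     (if \<alpha> \<in> monomials m d then multinom m d \<alpha> * monomial_at m x \<alpha> else 0)"
proof (induction d arbitrary: \<alpha>)
  case 0
  have "\<alpha> \<in> monomials m 0 \<longleftrightarrow> \<alpha> = 0"
    by (auto simp: monomials_def in_keys_iff subset_iff poly_mapping_eq_iff fun_eq_iff)
  then show ?case
    by (auto simp: multinom_def monomial_at_def lookup_one when_def)
next
  case (Suc d)
  let ?e = "\<lambda>j. Poly_Mapping.single j (1::nat)"
  have lf: "lin_form m x = (\<Sum>j<m. Poly_Mapping.single (?e j) (x $ j))"
    unfolding lin_form_def const_poly_def monom_poly_def by (simp add: mult_single)
  have look: "Poly_Mapping.lookup (lin_form m x ^ Suc d) \<alpha> =
      (\<Sum>j<m. Poly_Mapping.lookup (Poly_Mapping.single (?e j) (x $ j) * lin_form m x ^ d) \<alpha>)"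
    by (simp add: lf sum_distrib_right lookup_sum)
  have "Poly_Mapping.lookup (Poly_Mapping.single (?e j) (x $ j) * lin_form m x ^ d) \<alpha> =
      (if \<alpha> \<in> monomials m (Suc d)
       then of_nat (Poly_Mapping.lookup \<alpha> j) * (multinom m (Suc d) \<alpha> * monomial_at m x \<alpha> / of_nat (Suc d))
       else 0)" if j: "j < m" for j
  proof (cases "Poly_Mapping.lookup \<alpha> j > 0")
    case True
    then obtain \<beta> where \<alpha>: "\<alpha> = ?e j + \<beta>" by (rule split_off_variable)
    have "of_nat (Suc d) \<noteq> (0::complex)" by (simp only: of_nat_eq_0_iff)
    moreover have "Poly_Mapping.lookup \<alpha> j = Suc (Poly_Mapping.lookup \<beta> j)"
      by (simp add: \<alpha> lookup_add)
    ultimately show ?thesis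
      using multinom_single_add[OF j, of \<beta> d] single_add_in_monomials_iff[OF j, of \<beta> d]
        monomial_at_single[OF j, of x]
      unfolding \<alpha> lookup_single_times_add Suc.IH monomial_at_add
      by (auto simp: field_simps simp del: of_nat_Suc)
  next
    case False
    have "\<alpha> \<noteq> ?e j + \<beta>" for \<beta>
      using False by (auto simp: lookup_add)
    from lookup_single_times_other[OF this] False show ?thesis by simp
  qed
  then have "Poly_Mapping.lookup (lin_form m x ^ Suc d) \<alpha> =
     (if \<alpha> \<in> monomials m (Suc d) then (\<Sum>j<m. of_nat (Poly_Mapping.lookup \<alpha> j)) *
        (multinom m (Suc d) \<alpha> * monomial_at m x \<alpha> / of_nat (Suc d)) else 0)"
    unfolding look by (simp add: sum_distrib_right sum_divide_distrib del: of_nat_Suc)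
  moreover have "(\<Sum>j<m. of_nat (Poly_Mapping.lookup \<alpha> j)) = (of_nat (Suc d) :: complex)"
    if "\<alpha> \<in> monomials m (Suc d)"
    using that by (auto simp: monomials_def simp flip: of_nat_sum)
  moreover have "of_nat (Suc d) \<noteq> (0::complex)" by (simp only: of_nat_eq_0_iff)
  ultimately show ?case by (simp del: of_nat_Suc)
qed

lemma lookup_waring_sum:
  "Poly_Mapping.lookup (\<Sum>i<s. const_poly (\<omega> i) * lin_form m (\<xi> i) ^ d) \<alpha> =
    (if \<alpha> \<in> monomials m d then multinom m d \<alpha> * (\<Sum>i<s. \<omega> i * monomial_at m (\<xi> i) \<alpha>) else 0)"
proof -
  have "Poly_Mapping.lookup (const_poly (\<omega> i) * lin_form m (\<xi> i) ^ d) \<alpha> =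
      (if \<alpha> \<in> monomials m d then multinom m d \<alpha> * (\<omega> i * monomial_at m (\<xi> i) \<alpha>) else 0)" for i
    using lookup_single_times_add[of 0 "\<omega> i" "lin_form m (\<xi> i) ^ d" \<alpha>]
    by (simp add: const_poly_def lookup_lin_form_power)
  then show ?thesis by (simp add: lookup_sum sum_distrib_left)
qed

text \<open>
  A decomposition is a solution of the moment problem given by the scaled coefficients of \<open>T\<close>.
  All later arguments use decompositions in this form.
\<close>

lemma is_decomp_iff_moments:
  assumes T: "T \<in> homog m d"
  shows "is_decomp m d T s \<omega> \<xi> \<longleftrightarrow> (\<forall>i<s. \<xi> i \<in> carrier_vec m) \<and>
    (\<forall>\<alpha>\<in>monomials m d. scaled_coeff m d T \<alpha> = (\<Sum>i<s. \<omega> i * monomial_at m (\<xi> i) \<alpha>))"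
proof -
  have "Poly_Mapping.lookup T \<alpha> = 0" if "\<alpha> \<notin> monomials m d" for \<alpha>
    using T that by (auto simp: homog_def in_keys_iff)
  then have "T = (\<Sum>i<s. const_poly (\<omega> i) * lin_form m (\<xi> i) ^ d) \<longleftrightarrow>
    (\<forall>\<alpha>\<in>monomials m d. Poly_Mapping.lookup T \<alpha> = multinom m d \<alpha> * (\<Sum>i<s. \<omega> i * monomial_at m (\<xi> i) \<alpha>))"
    unfolding poly_mapping_eq_iff fun_eq_iff lookup_waring_sum by metis
  then show ?thesis
    unfolding is_decomp_def scaled_coeff_def
    using multinom_nonzero by (auto simp: field_simps)
qed

text \<open>
  Pairing with a monomial reads off a conjugated moment; this is where the conjugate points
  come from.
\<close>

lemma apolar_monom:
  assumes "\<gamma> \<in> monomials m d"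
  shows "apolar m d T (monom_poly \<gamma>) = cnj (scaled_coeff m d T \<gamma>)"
proof -
  have "apolar m d T (monom_poly \<gamma>) =
      (\<Sum>\<alpha>\<in>monomials m d. if \<alpha> = \<gamma> then cnj (scaled_coeff m d T \<gamma>) else 0)"
    unfolding apolar_def
    by (rule sum.cong)
      (auto simp: monom_poly_def scaled_coeff_def lookup_single when_def multinom_nonzero)
  then show ?thesis using assms by simp
qed

section \<open>Points separated by forms of a given degree\<close>

text \<open>
  The evaluations of degree \<open>k\<close> forms at the points are linearly independent, which over a field
  is equivalent to the existence of an interpolation family in degree \<open>k\<close>.  This dual form is
  easier to carry from one degree or one set of points to another.
\<close>

definition separates :: "nat \<Rightarrow> nat \<Rightarrow> nat \<Rightarrow> (nat \<Rightarrow> complex vec) \<Rightarrow> bool" where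
  "separates m k r x \<longleftrightarrow>
     (\<forall>a. (\<forall>\<alpha>\<in>monomials m k. (\<Sum>j<r. a j * monomial_at m (x j) \<alpha>) = 0) \<longrightarrow> (\<forall>j<r. a j = 0))"

lemma separatesD:
  assumes "separates m k r x"
    and "\<And>\<alpha>. \<alpha> \<in> monomials m k \<Longrightarrow> (\<Sum>j<r. a j * monomial_at m (x j) \<alpha>) = 0" and "j < r"
  shows "a j = 0"
  using assms unfolding separates_def by blast

lemma interp_family_separates:
  assumes u: "interp_family m k r \<xi> u"
  shows "separates m k r \<xi>"
  unfolding separates_def
proof (intro allI impI)
  fix a i
  assume a: "\<forall>\<alpha>\<in>monomials m k. (\<Sum>j<r. a j * monomial_at m (\<xi> j) \<alpha>) = 0" and i: "i < r"
  have ui: "Poly_Mapping.keys (u i) \<subseteq> monomials m k"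
    using u i by (simp add: interp_family_def homog_def)
  have ev: "eval_poly m (u i) x =
      (\<Sum>\<alpha>\<in>monomials m k. Poly_Mapping.lookup (u i) \<alpha> * monomial_at m x \<alpha>)" for x
    unfolding eval_poly_def monomial_at_def
    by (rule sum.mono_neutral_left) (use ui in \<open>auto simp: in_keys_iff\<close>)
  have "a i = (\<Sum>j<r. a j * (if i = j then 1 else 0))"
    using i by (simp add: if_distrib[of "\<lambda>z. _ * z"] sum.delta' cong: if_cong)
  also have "\<dots> = (\<Sum>j<r. a j * eval_poly m (u i) (\<xi> j))"
    using u i by (intro sum.cong) (auto simp: interp_family_def)
  also have "\<dots> = (\<Sum>j<r. \<Sum>\<alpha>\<in>monomials m k. Poly_Mapping.lookup (u i) \<alpha> * (a j * monomial_at m (\<xi> j) \<alpha>))"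
    by (simp add: ev sum_distrib_left mult_ac)
  also have "\<dots> = (\<Sum>\<alpha>\<in>monomials m k. Poly_Mapping.lookup (u i) \<alpha> * (\<Sum>j<r. a j * monomial_at m (\<xi> j) \<alpha>))"
    by (subst sum.swap) (simp add: sum_distrib_left)
  also have "\<dots> = 0" using a by simp
  finally show "a i = 0" .
qed

text \<open>
  A relation in degree \<open>k + 1\<close>, read at the multiples of \<open>X\<^sub>i\<close>, is a relation in degree \<open>k\<close>
  whose coefficients are multiplied by the \<open>i\<close>-th coordinates.  So those products vanish for every
  \<open>i\<close>, and each point has some nonzero coordinate.
\<close>

lemma separates_Suc:
  assumes sep: "separates m k r x" and nz: "\<And>j. j < r \<Longrightarrow> \<exists>i<m. x j $ i \<noteq> 0"
  shows "separates m (Suc k) r x"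
  unfolding separates_def
proof (intro allI impI)
  fix a j
  assume a: "\<forall>\<alpha>\<in>monomials m (Suc k). (\<Sum>j<r. a j * monomial_at m (x j) \<alpha>) = 0" and j: "j < r"
  obtain i where i: "i < m" "x j $ i \<noteq> 0" using nz[OF j] by blast
  have "a j * x j $ i = 0"
  proof (rule separatesD[OF sep _ j])
    fix \<beta> assume "\<beta> \<in> monomials m k"
    then have "Poly_Mapping.single i 1 + \<beta> \<in> monomials m (Suc k)"
      using single_add_in_monomials_iff[OF i(1)] by simp
    then have "(\<Sum>j<r. a j * monomial_at m (x j) (Poly_Mapping.single i 1 + \<beta>)) = 0" using a by blast
    then show "(\<Sum>j<r. a j * x j $ i * monomial_at m (x j) \<beta>) = 0"
      unfolding monomial_at_add monomial_at_single[OF i(1)] by (simp add: mult_ac)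
  qed
  then show "a j = 0" using i by simp
qed

lemma separates_mono:
  assumes "separates m k r x" "k \<le> l" and nz: "\<And>j. j < r \<Longrightarrow> \<exists>i<m. x j $ i \<noteq> 0"
  shows "separates m l r x"
  using assms(2,1) by (induction l rule: dec_induct) (auto intro: separates_Suc nz)

lemma separates_conjugate:
  assumes sep: "separates m k r x" and x: "\<And>j. j < r \<Longrightarrow> x j \<in> carrier_vec m"
  shows "separates m k r (\<lambda>j. conjugate (x j))"
  unfolding separates_def
proof (intro allI impI)
  fix a j
  assume a: "\<forall>\<alpha>\<in>monomials m k. (\<Sum>j<r. a j * monomial_at m (conjugate (x j)) \<alpha>) = 0" and j: "j < r"
  have "cnj (a j) = 0"
  proof (rule separatesD[OF sep _ j])
    fix \<alpha> assume "\<alpha> \<in> monomials m k"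
    then have "cnj (\<Sum>j<r. a j * monomial_at m (conjugate (x j)) \<alpha>) = 0" using a by simp
    then show "(\<Sum>j<r. cnj (a j) * monomial_at m (x j) \<alpha>) = 0"
      using x by (simp add: monomial_at_cnj)
  qed
  then show "a j = 0" by simp
qed

text \<open>
  The zero vector kills all monomials of positive degree, so it cannot be one of the points.
  In degree \<open>0\<close> this fails for a single point.
\<close>

lemma separates_nonzero:
  assumes sep: "separates m k r x" and "k \<ge> 1" "l < r"
  shows "\<exists>i<m. x l $ i \<noteq> 0"
proof (rule ccontr)
  assume "\<not> ?thesis"
  then have "monomial_at m (x l) \<alpha> = 0" if "\<alpha> \<in> monomials m k" for \<alpha>
    using monomial_at_zero[OF that assms(2), of "x l"] by blast
  then have "(if l = l then 1 else 0) = (0::complex)"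
    by (intro separatesD[OF sep _ assms(3), where a = "\<lambda>j. if j = l then 1 else 0"] sum.neutral) auto
  then show False by simp
qed

lemma separates_not_parallel:
  assumes sep: "separates m k r x" and "p < r" "q < r" "p \<noteq> q"
    and par: "\<And>i. i < m \<Longrightarrow> x q $ i = s * x p $ i"
  shows False
proof -
  \<comment> \<open>The relation \<open>s\<^sup>k v(x\<^sub>p) - v(x\<^sub>q) = 0\<close>.\<close>
  let ?a = "\<lambda>j. if j = p then s ^ k else if j = q then -1 else (0::complex)"
  have "?a q = 0"
  proof (rule separatesD[OF sep _ assms(3), where a = ?a])
    fix \<alpha> assume \<alpha>: "\<alpha> \<in> monomials m k"
    have "(\<Sum>j<r. ?a j * monomial_at m (x j) \<alpha>) = (\<Sum>j\<in>{p, q}. ?a j * monomial_at m (x j) \<alpha>)"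
      using assms by (intro sum.mono_neutral_right) auto
    also have "\<dots> = 0" using assms(4) monomial_at_scale[OF \<alpha> par] by simp
    finally show "(\<Sum>j<r. ?a j * monomial_at m (x j) \<alpha>) = 0" .
  qed
  then show False using assms(4) by simp
qed

text \<open>
  The common core of identifiability and of the recovery of the points from a diagonalisation.
  For fixed \<open>j\<close> the vectors \<open>\<Sum>\<^sub>l B\<^sub>l\<^sub>j x\<^sub>l\<^sub>,\<^sub>i v(x\<^sub>l)\<close>, for varying \<open>i\<close>, are all multiples of one
  vector, with the coordinates of \<open>y\<^sub>j\<close> as factors.  Eliminating that vector from two of these
  equations and using the independence of the \<open>v(x\<^sub>l)\<close> shows that the \<open>2 \<times> 2\<close> minors of
  \<open>(x\<^sub>l, y\<^sub>j)\<close> vanish whenever \<open>B\<^sub>l\<^sub>j \<noteq> 0\<close>.  Hence each \<open>x\<^sub>l\<close> is proportional to some \<open>y\<^sub>j\<close>.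
  Distinct \<open>x\<^sub>l\<close> lie on distinct lines, so the assignment \<open>l \<mapsto> j\<close> is injective, hence a
  permutation.
\<close>

lemma matching_points:
  fixes B :: "nat \<Rightarrow> nat \<Rightarrow> complex" and y :: "nat \<Rightarrow> complex vec"
  assumes sep: "separates m k r x" and nz: "\<And>l. l < r \<Longrightarrow> \<exists>i<m. x l $ i \<noteq> 0"
    and rows: "\<And>l. l < r \<Longrightarrow> \<exists>j<r. B l j \<noteq> 0"
    and eq: "\<And>j i \<alpha>. j < r \<Longrightarrow> i < m \<Longrightarrow> \<alpha> \<in> monomials m k \<Longrightarrow>
      (\<Sum>l<r. B l j * x l $ i * monomial_at m (x l) \<alpha>) = y j $ i * w j \<alpha>"
  obtains \<tau> c where "bij_betw \<tau> {..<r} {..<r}"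
    and "\<And>l. l < r \<Longrightarrow> c l \<noteq> 0" and "\<And>l i. l < r \<Longrightarrow> i < m \<Longrightarrow> y (\<tau> l) $ i = c l * x l $ i"
proof -
  have minors: "B l j * (y j $ i' * x l $ i - y j $ i * x l $ i') = 0"
    if "j < r" "i < m" "i' < m" "l < r" for j i i' l
  proof (rule separatesD[OF sep _ that(4)])
    fix \<alpha> assume \<alpha>: "\<alpha> \<in> monomials m k"
    have "(\<Sum>l<r. B l j * (y j $ i' * x l $ i - y j $ i * x l $ i') * monomial_at m (x l) \<alpha>) =
        y j $ i' * (\<Sum>l<r. B l j * x l $ i * monomial_at m (x l) \<alpha>)
        - y j $ i * (\<Sum>l<r. B l j * x l $ i' * monomial_at m (x l) \<alpha>)"
      by (simp add: sum_distrib_left sum_subtractf[symmetric] algebra_simps)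
    also have "\<dots> = 0" using eq[OF that(1,2) \<alpha>] eq[OF that(1,3) \<alpha>] by simp
    finally show "(\<Sum>l<r. B l j * (y j $ i' * x l $ i - y j $ i * x l $ i') * monomial_at m (x l) \<alpha>) = 0" .
  qed
  have "\<forall>l<r. \<exists>j s. j < r \<and> s \<noteq> 0 \<and> (\<forall>i<m. y j $ i = s * x l $ i)"
  proof (intro allI impI)
    fix l assume l: "l < r"
    obtain j where j: "j < r" "B l j \<noteq> 0" using rows[OF l] by blast
    obtain i0 where i0: "i0 < m" "x l $ i0 \<noteq> 0" using nz[OF l] by blast
    \<comment> \<open>A coordinate at which \<open>x\<^sub>l\<close> is nonzero determines the factor of proportionality.\<close>
    let ?s = "y j $ i0 / x l $ i0"
    have par: "y j $ i = ?s * x l $ i" if "i < m" for i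
      using minors[OF j(1) that i0(1) l] j i0 by (simp add: field_simps)
    have "?s \<noteq> 0"
    proof
      assume "?s = 0"
      then have "B l j * x l $ i0 = 0"
        using eq[OF j(1) i0(1)] i0 by (intro separatesD[OF sep _ l, where a = "\<lambda>l. B l j * x l $ i0"]) auto
      then show False using j i0 by simp
    qed
    then show "\<exists>j s. j < r \<and> s \<noteq> 0 \<and> (\<forall>i<m. y j $ i = s * x l $ i)" using j par by blast
  qed
  then obtain \<tau> c where \<tau>: "\<And>l. l < r \<Longrightarrow> \<tau> l < r" and c: "\<And>l. l < r \<Longrightarrow> c l \<noteq> 0"
    and yx: "\<And>l i. l < r \<Longrightarrow> i < m \<Longrightarrow> y (\<tau> l) $ i = c l * x l $ i" by metis
  have inj: "inj_on \<tau> {..<r}"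
  proof (rule inj_onI, rule ccontr)
    fix p q assume pq: "p \<in> {..<r}" "q \<in> {..<r}" "\<tau> p = \<tau> q" "p \<noteq> q"
    show False
    proof (rule separates_not_parallel[OF sep])
      show "x q $ i = c p / c q * x p $ i" if "i < m" for i
        using yx[of p i] yx[of q i] c[of q] pq that by (simp add: field_simps)
    qed (use pq in auto)
  qed
  then have "bij_betw \<tau> {..<r} {..<r}"
    using \<tau> endo_inj_surj[of "{..<r}" \<tau>] by (auto simp: bij_betw_def)
  then show thesis using that c yx by blast
qed

section \<open>The Veronese matrix and the Hankel operator\<close>

definition veronese :: "nat \<Rightarrow> nat \<Rightarrow> nat \<Rightarrow> (nat \<Rightarrow> complex vec) \<Rightarrow> complex mat" where
  "veronese m k r x = mat (num_monomials m k) r (\<lambda>(a, j). monomial_at m (x j) (mon m k a))"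

lemma veronese_carrier [simp]: "veronese m k r x \<in> carrier_mat (num_monomials m k) r"
  by (simp add: veronese_def)

lemma veronese_mult_index:
  assumes "B \<in> carrier_mat r q" "\<alpha> \<in> monomials m k" "j < q"
  shows "(veronese m k r x * B) $$ (mon_index m k \<alpha>, j) = (\<Sum>l<r. monomial_at m (x l) \<alpha> * B $$ (l, j))"
  using assms mon_index[OF assms(2)]
  by (auto simp: veronese_def scalar_prod_def atLeast0LessThan intro!: sum.cong)

lemma injective_veronese_iff: "injective_mat (veronese m k r x) \<longleftrightarrow> separates m k r x"
proof
  assume inj: "injective_mat (veronese m k r x)"
  show "separates m k r x"
    unfolding separates_def
  proof (intro allI impI)
    fix a j assume a: "\<forall>\<alpha>\<in>monomials m k. (\<Sum>j<r. a j * monomial_at m (x j) \<alpha>) = 0" and j: "j < r"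
    have "veronese m k r x *\<^sub>v vec r a = 0\<^sub>v (num_monomials m k)"
    proof (rule eq_vecI)
      fix i assume "i < dim_vec (0\<^sub>v (num_monomials m k) :: complex vec)"
      then have i: "i < num_monomials m k" by simp
      then show "(veronese m k r x *\<^sub>v vec r a) $ i = 0\<^sub>v (num_monomials m k) $ i"
        using bspec[OF a mon_in_monomials[OF i]]
        by (simp add: veronese_def scalar_prod_def atLeast0LessThan mult.commute)
    qed (simp add: veronese_def)
    then have "vec r a = 0\<^sub>v r"
      using inj unfolding injective_mat_def by (auto simp: veronese_def)
    then have "vec r a $ j = 0" using j by simp
    then show "a j = 0" using j by simp
  qed
next
  assume sep: "separates m k r x"
  show "injective_mat (veronese m k r x)"
    unfolding injective_mat_def
  proof (intro ballI impI)
    fix v assume v: "v \<in> carrier_vec (dim_col (veronese m k r x))"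
      and z: "veronese m k r x *\<^sub>v v = 0\<^sub>v (dim_row (veronese m k r x))"
    have v': "dim_vec v = r" using v by (simp add: veronese_def)
    have "v $ j = 0" if "j < r" for j
    proof (rule separatesD[OF sep _ that])
      fix \<alpha> assume \<alpha>: "\<alpha> \<in> monomials m k"
      have "(veronese m k r x *\<^sub>v v) $ mon_index m k \<alpha> = 0"
        using z mon_index[OF \<alpha>] by (simp add: veronese_def)
      then show "(\<Sum>j<r. v $ j * monomial_at m (x j) \<alpha>) = 0"
        using mon_index[OF \<alpha>] v'
        by (simp add: veronese_def scalar_prod_def atLeast0LessThan mult.commute)
    qed
    then show "v = 0\<^sub>v (dim_col (veronese m k r x))"
      using v' by (intro eq_vecI) (auto simp: veronese_def)
  qed
qed

text \<open>
  Passing to the rows divisible by \<open>X\<^sub>i\<close> lowers the degree by one and scales each column by the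
  \<open>i\<close>-th coordinate of its point.
\<close>

lemma shift_submat_veronese:
  assumes G: "G \<in> carrier_mat r q" and i: "i < m" and k: "k \<ge> 1"
  shows "shift_submat m k (veronese m k r x * G) i =
    veronese m (k - 1) r x * (mat_diag r (\<lambda>l. x l $ i) * G)"
proof (rule eq_matI)
  fix a j
  assume "a < dim_row (veronese m (k - 1) r x * (mat_diag r (\<lambda>l. x l $ i) * G))"
    "j < dim_col (veronese m (k - 1) r x * (mat_diag r (\<lambda>l. x l $ i) * G))"
  then have a: "a < num_monomials m (k - 1)" and j: "j < q" using G by (auto simp: veronese_def)
  let ?\<alpha> = "mon m (k - 1) a"
  have "Poly_Mapping.single i 1 + ?\<alpha> \<in> monomials m k"
    using single_add_in_monomials_iff[OF i, of ?\<alpha> "k - 1"] mon_in_monomials[OF a] k by simp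
  from veronese_mult_index[OF G this j, of x]
  show "shift_submat m k (veronese m k r x * G) i $$ (a, j) =
      (veronese m (k - 1) r x * (mat_diag r (\<lambda>l. x l $ i) * G)) $$ (a, j)"
    using a j G monomial_at_single[OF i]
    by (auto simp: shift_submat_def veronese_def monomial_at_add mat_diag_mult_left[OF G]
        scalar_prod_def atLeast0LessThan mult_ac intro!: sum.cong)
qed (use G in \<open>auto simp: shift_submat_def veronese_def\<close>)

text \<open>
  The Hankel matrix is a Vandermonde-like product of a matrix in degree \<open>k\<close>, the weights, and the
  transpose of a matrix in degree \<open>d - k\<close>; here the last two are merged.
\<close>

lemma hankel_mat_factor:
  assumes T: "T \<in> homog m d" and dec: "is_decomp m d T r \<omega> \<xi>" and k: "k \<le> d"
  shows "hankel_mat m d k T = veronese m k r (\<lambda>j. conjugate (\<xi> j)) *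
    mat r (num_monomials m (d - k))
      (\<lambda>(l, b). cnj (\<omega> l) * monomial_at m (conjugate (\<xi> l)) (mon m (d - k) b))"
    (is "_ = _ * ?W")
proof (rule eq_matI)
  fix a b
  assume "a < dim_row (veronese m k r (\<lambda>j. conjugate (\<xi> j)) * ?W)"
    "b < dim_col (veronese m k r (\<lambda>j. conjugate (\<xi> j)) * ?W)"
  then have a: "a < num_monomials m k" and b: "b < num_monomials m (d - k)"
    by (auto simp: veronese_def)
  let ?\<gamma> = "mon m k a + mon m (d - k) b"
  have \<gamma>: "?\<gamma> \<in> monomials m d"
    using monomials_add[OF mon_in_monomials[OF a] mon_in_monomials[OF b]] k by simp
  have "apolar m d T (monom_poly ?\<gamma>) = cnj (\<Sum>i<r. \<omega> i * monomial_at m (\<xi> i) ?\<gamma>)"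
    using apolar_monom[OF \<gamma>, of T] dec \<gamma> unfolding is_decomp_iff_moments[OF T] by simp
  also have "\<dots> = (\<Sum>i<r. cnj (\<omega> i) * monomial_at m (conjugate (\<xi> i)) ?\<gamma>)"
    using dec by (auto simp: is_decomp_def monomial_at_cnj intro!: sum.cong)
  finally show "hankel_mat m d k T $$ (a, b) = (veronese m k r (\<lambda>j. conjugate (\<xi> j)) * ?W) $$ (a, b)"
    using a b by (simp add: hankel_mat_def veronese_def scalar_prod_def atLeast0LessThan
        monomial_at_add mult_ac)
qed (auto simp: hankel_mat_def veronese_def)

lemma hankel_image:
  "hankel m d k T ` homog m (d - k) =
    (\<lambda>v. hankel_mat m d k T *\<^sub>v v) ` carrier_vec (num_monomials m (d - k))"
proof (intro equalityI subsetI)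
  fix y assume "y \<in> hankel m d k T ` homog m (d - k)"
  then show "y \<in> (\<lambda>v. hankel_mat m d k T *\<^sub>v v) ` carrier_vec (num_monomials m (d - k))"
    by (auto simp: hankel_eq_hankel_mat)
next
  let ?n = "num_monomials m (d - k)" and ?mon = "mon m (d - k)"
  fix y assume "y \<in> (\<lambda>v. hankel_mat m d k T *\<^sub>v v) ` carrier_vec ?n"
  then obtain v where v: "v \<in> carrier_vec ?n" and y: "y = hankel_mat m d k T *\<^sub>v v" by auto
  define p :: cpoly where "p = (\<Sum>b<?n. Poly_Mapping.single (?mon b) (v $ b))"
  have inj: "inj_on ?mon {..<?n}" using bij_betw_mon by (auto simp: bij_betw_def)
  have "Poly_Mapping.lookup p (?mon b) = v $ b" if "b < ?n" for b
  proof -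
    have "Poly_Mapping.lookup p (?mon b) = (\<Sum>c<?n. if c = b then v $ b else 0)"
      unfolding p_def lookup_sum
      by (rule sum.cong) (use that inj in \<open>auto simp: lookup_single when_def inj_on_def\<close>)
    then show ?thesis using that by simp
  qed
  then have "vec ?n (\<lambda>b. Poly_Mapping.lookup p (?mon b)) = v"
    using v by (intro eq_vecI) auto
  moreover have "p \<in> homog m (d - k)"
  proof -
    have "Poly_Mapping.lookup p \<alpha> = 0" if "\<alpha> \<notin> monomials m (d - k)" for \<alpha>
      unfolding p_def lookup_sum
      by (rule sum.neutral) (use that mon_in_monomials in \<open>auto simp: lookup_single when_def\<close>)
    then show ?thesis unfolding homog_def by (auto simp: in_keys_iff)
  qed
  ultimately show "y \<in> hankel m d k T ` homog m (d - k)"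
    using hankel_eq_hankel_mat[of p m d k T] y by (intro image_eqI[of _ _ p]) auto
qed

text \<open>
  A Hankel matrix of rank \<open>r\<close> that factors through \<open>\<complex>\<^sup>r\<close> forces its left factor to be injective
  and to have the same image.
\<close>

lemma full_hankel_rank:
  assumes T: "T \<in> homog m d" and dec: "is_decomp m d T r \<omega> \<xi>" and k: "k \<le> d"
    and rank: "hankel_rank m d k T = r"
  shows "separates m k r (\<lambda>j. conjugate (\<xi> j))"
    and "(\<lambda>v. veronese m k r (\<lambda>j. conjugate (\<xi> j)) *\<^sub>v v) ` carrier_vec r
      = hankel m d k T ` homog m (d - k)"
proof -
  let ?n = "num_monomials m (d - k)" and ?V = "veronese m k r (\<lambda>j. conjugate (\<xi> j))"
  obtain W where W: "W \<in> carrier_mat r ?n" and H: "hankel_mat m d k T = ?V * W"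
    by (rule that[OF _ hankel_mat_factor[OF T dec k]]) simp
  have rk: "vec_space.rank (num_monomials m k) (?V * W) = r"
    using rank H unfolding hankel_rank_def by simp
  show "separates m k r (\<lambda>j. conjugate (\<xi> j))"
    using full_rank_product(1)[OF veronese_carrier W rk] injective_veronese_iff by blast
  show "(\<lambda>v. ?V *\<^sub>v v) ` carrier_vec r = hankel m d k T ` homog m (d - k)"
    unfolding hankel_image H
  proof (intro equalityI subsetI)
    fix y assume "y \<in> (\<lambda>v. ?V *\<^sub>v v) ` carrier_vec r"
    then obtain v where v: "v \<in> carrier_vec r" "y = ?V *\<^sub>v v" by auto
    obtain w where "w \<in> carrier_vec ?n" "?V * W *\<^sub>v w = ?V *\<^sub>v v"
      using full_rank_product(2)[OF veronese_carrier W rk v(1)] by blast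
    then show "y \<in> (\<lambda>v. ?V * W *\<^sub>v v) ` carrier_vec ?n"
      using v(2) by (intro image_eqI[of _ _ w]) auto
  next
    fix y assume "y \<in> (\<lambda>v. ?V * W *\<^sub>v v) ` carrier_vec ?n"
    then obtain v where v: "v \<in> carrier_vec ?n" "y = ?V * W *\<^sub>v v" by auto
    then have "y = ?V *\<^sub>v (W *\<^sub>v v)" using assoc_mult_mat_vec[OF veronese_carrier W] by simp
    then show "y \<in> (\<lambda>v. ?V *\<^sub>v v) ` carrier_vec r" using W v by auto
  qed
qed

text \<open>
  A decomposition shorter than the Hankel rank could be padded with zero vectors to one whose
  length equals the rank.  But the points of such a decomposition are separated in degree \<open>k \<ge> 1\<close>,
  so none of them is zero.
\<close>

lemma hankel_rank_le_length:
  assumes T: "T \<in> homog m d" and dec: "is_decomp m d T s \<omega> \<xi>" and k: "1 \<le> k" "k \<le> d"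
  shows "hankel_rank m d k T \<le> s"
proof (rule ccontr)
  let ?r = "hankel_rank m d k T"
  assume "\<not> ?r \<le> s"
  then have s: "s < ?r" by simp
  \<comment> \<open>Index \<open>s\<close> becomes the first padded, hence zero, point.\<close>
  let ?\<omega> = "\<lambda>i. if i < s then \<omega> i else 0" and ?\<xi> = "\<lambda>i. if i < s then \<xi> i else 0\<^sub>v m"
  have "(\<Sum>i<?r. ?\<omega> i * monomial_at m (?\<xi> i) \<alpha>) = (\<Sum>i<s. \<omega> i * monomial_at m (\<xi> i) \<alpha>)" for \<alpha>
    by (rule sum.mono_neutral_cong_right) (use s in auto)
  then have "is_decomp m d T ?r ?\<omega> ?\<xi>"
    using dec unfolding is_decomp_iff_moments[OF T] by auto
  from full_hankel_rank(1)[OF T this k(2) refl]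
  have "\<exists>i<m. conjugate (?\<xi> s) $ i \<noteq> 0" using s k(1) by (intro separates_nonzero) auto
  then show False by auto
qed

section \<open>Lines of the points and uniqueness of decompositions\<close>

text \<open>
  Expressing the columns of each matrix by those of the other gives square factors, which are
  mutually inverse because \<open>A\<close> can be cancelled on the left.
\<close>

lemma same_image_factor:
  fixes A A' :: "complex mat"
  assumes A: "A \<in> carrier_mat n r" and A': "A' \<in> carrier_mat n r" and inj: "injective_mat A"
    and img: "(\<lambda>v. A' *\<^sub>v v) ` carrier_vec r = (\<lambda>v. A *\<^sub>v v) ` carrier_vec r"
  obtains B B' where "B \<in> carrier_mat r r" "B' \<in> carrier_mat r r"
    and "A' = A * B" "B * B' = 1\<^sub>m r" "B' * B = 1\<^sub>m r"
proof -
  have factor: "\<exists>B\<in>carrier_mat r r. Y = X * B"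
    if X: "X \<in> carrier_mat n r" and Y: "Y \<in> carrier_mat n r"
      and sub: "(\<lambda>v. Y *\<^sub>v v) ` carrier_vec r \<subseteq> (\<lambda>v. X *\<^sub>v v) ` carrier_vec r" for X Y :: "complex mat"
  proof -
    have "\<exists>b. b \<in> carrier_vec r \<and> col Y j = X *\<^sub>v b" if j: "j < r" for j
    proof -
      have "col Y j = Y *\<^sub>v unit_vec r j" using mult_unit_vec_col[OF Y j] by simp
      then have "col Y j \<in> (\<lambda>v. X *\<^sub>v v) ` carrier_vec r"
        using sub unit_vec_carrier[of r j] by blast
      then show ?thesis by auto
    qed
    then obtain b where b: "\<And>j. j < r \<Longrightarrow> b j \<in> carrier_vec r"
      "\<And>j. j < r \<Longrightarrow> col Y j = X *\<^sub>v b j" by metis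
    let ?B = "mat_of_cols r (map b [0..<r])"
    have B: "?B \<in> carrier_mat r r" using mat_of_cols_carrier(1)[of r "map b [0..<r]"] by simp
    have "Y = X * ?B"
      by (rule mat_col_eqI) (use X Y B b in \<open>auto simp: col_mult2[OF X B]\<close>)
    then show ?thesis using B by blast
  qed
  obtain B where B: "B \<in> carrier_mat r r" "A' = A * B" using factor[OF A A'] img by blast
  obtain B' where B': "B' \<in> carrier_mat r r" "A = A' * B'" using factor[OF A' A] img by blast
  have "A * (B * B') = A' * B'" using assoc_mult_mat[OF A B(1) B'(1)] B(2) by simp
  also have "\<dots> = A * 1\<^sub>m r" unfolding B'(2)[symmetric] using A by simp
  finally have eq: "A * (B * B') = A * 1\<^sub>m r" .
  have BB': "B * B' = 1\<^sub>m r"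
    by (rule injective_mat_cancel[OF inj A mult_carrier_mat[OF B(1) B'(1)] one_carrier_mat eq])
  show thesis
    by (rule that[OF B(1) B'(1) B(2) BB' mat_mult_left_right_inverse[OF B(1) B'(1) BB']])
qed

lemma right_invertible_row_nonzero:
  fixes B :: "complex mat"
  assumes "B \<in> carrier_mat r r" "B' \<in> carrier_mat r r" "B * B' = 1\<^sub>m r" "l < r"
  shows "\<exists>j<r. B $$ (l, j) \<noteq> 0"
proof (rule ccontr)
  assume "\<not> ?thesis"
  then have "row B l \<bullet> col B' l = 0"
    using assms(1,2,4) unfolding scalar_prod_def by (intro sum.neutral) simp
  moreover have "row B l \<bullet> col B' l = (B * B') $$ (l, l)"
    using assms(1,2,4) by simp
  ultimately show False using assms(3,4) by simp
qed

text \<open>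
  If \<open>V(y) = V(x) B\<close> in degree \<open>k\<close>, then the rows divisible by \<open>X\<^sub>i\<close> express
  \<open>y\<^sub>j\<^sub>,\<^sub>i v(y\<^sub>j)\<close> in degree \<open>k - 1\<close> by the \<open>x\<^sub>l\<^sub>,\<^sub>i v(x\<^sub>l)\<close>, so the points match up.  The
  roles of \<open>x\<close> and \<open>y\<close> differ because the interpolation degree of a competing decomposition is
  not under control.
\<close>

lemma same_veronese_image_match:
  assumes sep: "separates m (k - 1) r x" and k: "k \<ge> 1"
    and nz: "\<And>l. l < r \<Longrightarrow> \<exists>i<m. x l $ i \<noteq> 0"
    and img: "(\<lambda>v. veronese m k r y *\<^sub>v v) ` carrier_vec r = (\<lambda>v. veronese m k r x *\<^sub>v v) ` carrier_vec r"
  obtains \<tau> c where "bij_betw \<tau> {..<r} {..<r}"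
    and "\<And>l. l < r \<Longrightarrow> c l \<noteq> 0" and "\<And>l i. l < r \<Longrightarrow> i < m \<Longrightarrow> y (\<tau> l) $ i = c l * x l $ i"
proof -
  have "injective_mat (veronese m k r x)"
    using separates_mono[OF sep _ nz, of k] injective_veronese_iff by auto
  from same_image_factor[OF veronese_carrier veronese_carrier this img]
  obtain B B' where B: "B \<in> carrier_mat r r" "B' \<in> carrier_mat r r"
    "veronese m k r y = veronese m k r x * B" "B * B' = 1\<^sub>m r" by metis
  show thesis
  proof (rule matching_points[OF sep nz])
    show "\<exists>j<r. B $$ (l, j) \<noteq> 0" if "l < r" for l
      using right_invertible_row_nonzero[OF B(1,2,4) that] .
    show "(\<Sum>l<r. B $$ (l, j) * x l $ i * monomial_at m (x l) \<alpha>) = y j $ i * monomial_at m (y j) \<alpha>"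
      if j: "j < r" and i: "i < m" and \<alpha>: "\<alpha> \<in> monomials m (k - 1)" for j i \<alpha>
    proof -
      let ?\<beta> = "Poly_Mapping.single i 1 + \<alpha>"
      have \<beta>: "?\<beta> \<in> monomials m k"
        using single_add_in_monomials_iff[OF i, of \<alpha> "k - 1"] \<alpha> k by simp
      have "(\<Sum>l<r. monomial_at m (x l) ?\<beta> * B $$ (l, j)) = veronese m k r y $$ (mon_index m k ?\<beta>, j)"
        unfolding B(3) veronese_mult_index[OF B(1) \<beta> j] ..
      also have "\<dots> = monomial_at m (y j) ?\<beta>"
        using mon_index[OF \<beta>] j by (simp add: veronese_def)
      finally show ?thesis
        unfolding monomial_at_add monomial_at_single[OF i] by (simp add: mult_ac)
    qed
    fix \<tau> c assume "bij_betw \<tau> {..<r} {..<r}" "\<And>l. l < r \<Longrightarrow> c l \<noteq> 0"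
      and "\<And>l i. l < r \<Longrightarrow> i < m \<Longrightarrow> y (\<tau> l) $ i = c l * x l $ i"
    then show thesis by (rule that)
  qed
qed

lemma line_eq_if_proportional:
  assumes "v \<in> carrier_vec m" "w \<in> carrier_vec m" "c \<noteq> 0" and "\<And>i. i < m \<Longrightarrow> w $ i = c * v $ i"
  shows "line w = line v"
proof -
  have w: "w = c \<cdot>\<^sub>v v" using assms by (intro eq_vecI) auto
  have v: "v = inverse c \<cdot>\<^sub>v w" using assms by (intro eq_vecI) auto
  show ?thesis
    unfolding line_def
  proof (intro equalityI subsetI)
    fix z assume "z \<in> {a \<cdot>\<^sub>v w | a. True}"
    then show "z \<in> {a \<cdot>\<^sub>v v | a. True}" unfolding w by (auto simp: smult_smult_assoc)
  next
    fix z assume "z \<in> {a \<cdot>\<^sub>v v | a. True}"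
    then obtain a where "z = a \<cdot>\<^sub>v v" by auto
    then have "z = (a * inverse c) \<cdot>\<^sub>v w" by (subst (asm) v) (simp add: smult_smult_assoc)
    then show "z \<in> {a \<cdot>\<^sub>v w | a. True}" by auto
  qed
qed

lemma separates_inj_lines:
  assumes sep: "separates m k r x" and x: "\<And>j. j < r \<Longrightarrow> x j \<in> carrier_vec m"
  shows "inj_on (\<lambda>j. line (x j)) {..<r}"
proof (rule inj_onI, rule ccontr)
  fix p q assume pq: "p \<in> {..<r}" "q \<in> {..<r}" "line (x p) = line (x q)" "p \<noteq> q"
  have "x q \<in> line (x q)" unfolding line_def by (auto intro: exI[of _ 1])
  then obtain s where s: "x q = s \<cdot>\<^sub>v x p" using pq(3) by (auto simp: line_def)
  show False
  proof (rule separates_not_parallel[OF sep])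
    show "p < r" "q < r" "p \<noteq> q" using pq by auto
    show "x q $ i = s * x p $ i" if "i < m" for i
      using x[of p] pq(1) that unfolding s by auto
  qed
qed

text \<open>
  Replacing \<open>\<xi>\<^sub>l\<close> by \<open>c\<^sub>l \<xi>\<^sub>l\<close> multiplies its \<open>d\<close>-th power by \<open>c\<^sub>l\<^sup>d\<close>.  As the \<open>d\<close>-th powers at
  the \<open>\<xi>\<^sub>l\<close> are independent, the new weights have to be \<open>\<omega>\<^sub>l / c\<^sub>l\<^sup>d\<close>, up to the permutation.
\<close>

lemma rescaled_points_unique_weights:
  assumes T: "T \<in> homog m d" and dec: "is_decomp m d T r \<omega> \<xi>" and sep: "separates m d r \<xi>"
    and \<tau>: "bij_betw \<tau> {..<r} {..<r}" and c: "\<And>l. l < r \<Longrightarrow> c l \<noteq> 0"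
    and \<xi>': "\<And>l i. l < r \<Longrightarrow> i < m \<Longrightarrow> \<xi>' (\<tau> l) $ i = c l * \<xi> l $ i"
    and carr: "\<And>j. j < r \<Longrightarrow> \<xi>' j \<in> carrier_vec m"
  shows "\<exists>!\<omega>'. \<omega>' \<in> carrier_vec r \<and> is_decomp m d T r (\<lambda>j. \<omega>' $ j) \<xi>'"
proof -
  have char: "is_decomp m d T r \<omega>' \<xi>' \<longleftrightarrow> (\<forall>l<r. \<omega>' (\<tau> l) * c l ^ d = \<omega> l)" for \<omega>'
  proof -
    have sum: "(\<Sum>j<r. \<omega>' j * monomial_at m (\<xi>' j) \<alpha>) =
        (\<Sum>l<r. \<omega>' (\<tau> l) * c l ^ d * monomial_at m (\<xi> l) \<alpha>)" if \<alpha>: "\<alpha> \<in> monomials m d" for \<alpha>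
    proof -
      have "(\<Sum>j<r. \<omega>' j * monomial_at m (\<xi>' j) \<alpha>) = (\<Sum>l<r. \<omega>' (\<tau> l) * monomial_at m (\<xi>' (\<tau> l)) \<alpha>)"
        by (rule sum.reindex_bij_betw[OF \<tau>, symmetric])
      also have "\<dots> = (\<Sum>l<r. \<omega>' (\<tau> l) * c l ^ d * monomial_at m (\<xi> l) \<alpha>)"
        using monomial_at_scale[OF \<alpha> \<xi>'] by (intro sum.cong) (auto simp: mult_ac)
      finally show ?thesis .
    qed
    have T\<alpha>: "scaled_coeff m d T \<alpha> = (\<Sum>l<r. \<omega> l * monomial_at m (\<xi> l) \<alpha>)" if "\<alpha> \<in> monomials m d" for \<alpha>
      using dec that unfolding is_decomp_iff_moments[OF T] by blast
    show ?thesis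
    proof
      assume dec': "is_decomp m d T r \<omega>' \<xi>'"
      show "\<forall>l<r. \<omega>' (\<tau> l) * c l ^ d = \<omega> l"
      proof (intro allI impI)
        fix l assume l: "l < r"
        have "\<omega>' (\<tau> l) * c l ^ d - \<omega> l = 0"
        proof (rule separatesD[OF sep _ l])
          fix \<alpha> assume \<alpha>: "\<alpha> \<in> monomials m d"
          have "scaled_coeff m d T \<alpha> = (\<Sum>j<r. \<omega>' j * monomial_at m (\<xi>' j) \<alpha>)"
            using dec' \<alpha> unfolding is_decomp_iff_moments[OF T] by blast
          then show "(\<Sum>l<r. (\<omega>' (\<tau> l) * c l ^ d - \<omega> l) * monomial_at m (\<xi> l) \<alpha>) = 0"
            using sum[OF \<alpha>] T\<alpha>[OF \<alpha>] by (simp add: left_diff_distrib sum_subtractf)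
        qed
        then show "\<omega>' (\<tau> l) * c l ^ d = \<omega> l" by simp
      qed
    next
      assume "\<forall>l<r. \<omega>' (\<tau> l) * c l ^ d = \<omega> l"
      then show "is_decomp m d T r \<omega>' \<xi>'"
        unfolding is_decomp_iff_moments[OF T] using sum T\<alpha> carr by auto
    qed
  qed
  have inj: "inj_on \<tau> {..<r}" and img: "\<tau> ` {..<r} = {..<r}" using \<tau> by (auto simp: bij_betw_def)
  have \<tau>r: "\<tau> l < r" if "l < r" for l using img that by auto
  define \<sigma> where "\<sigma> = the_inv_into {..<r} \<tau>"
  have \<sigma>: "\<sigma> (\<tau> l) = l" if "l < r" for l
    unfolding \<sigma>_def using that by (intro the_inv_into_f_f[OF inj]) simp
  show ?thesis
  proof (rule ex1I[of _ "vec r (\<lambda>j. \<omega> (\<sigma> j) / c (\<sigma> j) ^ d)"])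
    show "vec r (\<lambda>j. \<omega> (\<sigma> j) / c (\<sigma> j) ^ d) \<in> carrier_vec r \<and>
        is_decomp m d T r (\<lambda>j. vec r (\<lambda>j. \<omega> (\<sigma> j) / c (\<sigma> j) ^ d) $ j) \<xi>'"
      unfolding char using \<tau>r \<sigma> c by auto
  next
    fix \<omega>' assume \<omega>': "\<omega>' \<in> carrier_vec r \<and> is_decomp m d T r (\<lambda>j. \<omega>' $ j) \<xi>'"
    show "\<omega>' = vec r (\<lambda>j. \<omega> (\<sigma> j) / c (\<sigma> j) ^ d)"
    proof (rule eq_vecI)
      fix j assume "j < dim_vec (vec r (\<lambda>j. \<omega> (\<sigma> j) / c (\<sigma> j) ^ d))"
      then have j: "j < r" by simp
      then obtain l where l: "l < r" "j = \<tau> l" using img by (metis imageE lessThan_iff)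
      have "\<omega>' $ \<tau> l * c l ^ d = \<omega> l" using \<omega>' l unfolding char by blast
      then show "\<omega>' $ j = vec r (\<lambda>j. \<omega> (\<sigma> j) / c (\<sigma> j) ^ d) $ j"
        using j l \<sigma> c[of l] by (simp add: field_simps)
    qed (use \<omega>' in auto)
  qed
qed

lemma waring_rank_eq_hankel_rank:
  assumes T: "T \<in> homog m d" and dec: "is_decomp m d T r \<omega> \<xi>" and k: "1 \<le> k" "k \<le> d"
    and rank: "hankel_rank m d k T = r"
  shows "waring_rank m d T = r"
  unfolding waring_rank_def
proof (rule Least_equality)
  show "\<exists>\<omega> \<xi>. is_decomp m d T r \<omega> \<xi>" using dec by blast
  show "r \<le> s" if "\<exists>\<omega> \<xi>. is_decomp m d T s \<omega> \<xi>" for s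
    using that hankel_rank_le_length[OF T _ k] rank by blast
qed

text \<open>
  The image of the Hankel operator depends on \<open>T\<close> alone, and for every decomposition of length
  \<open>r\<close> it is spanned by the evaluations at the conjugate points.  Two such decompositions thus have
  the same span, and their points agree up to order and scaling.
\<close>

lemma identifiable_if_full_hankel_rank:
  assumes T: "T \<in> homog m d" and dec: "is_decomp m d T r \<omega> \<xi>" and k: "1 \<le> k" "k \<le> d"
    and rank: "hankel_rank m d k T = r"
    and sep: "separates m (k - 1) r (\<lambda>j. conjugate (\<xi> j))"
  shows "identifiable m d T"
proof -
  have wr: "waring_rank m d T = r" by (rule waring_rank_eq_hankel_rank[OF T dec k rank])
  have \<xi>c: "\<And>j. j < r \<Longrightarrow> \<xi> j \<in> carrier_vec m" using dec by (simp add: is_decomp_def)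
  note full = full_hankel_rank[OF T dec k(2) rank]
  have nz: "\<exists>i<m. conjugate (\<xi> l) $ i \<noteq> 0" if "l < r" for l
    using separates_nonzero[OF full(1) k(1) that] .
  have inj: "inj_on (\<lambda>j. line (\<xi> j)) {..<r}"
  proof -
    have "separates m k r (\<lambda>j. conjugate (conjugate (\<xi> j)))"
      using \<xi>c by (intro separates_conjugate[OF full(1)]) auto
    then show ?thesis using separates_inj_lines[of m k r \<xi>] \<xi>c by simp
  qed
  have lines: "\<exists>\<tau>. bij_betw \<tau> {..<r} {..<r} \<and> (\<forall>l<r. line (\<xi>' (\<tau> l)) = line (\<xi> l))"
    if "is_decomp m d T r \<omega>' \<xi>'" for \<omega>' \<xi>'
  proof -
    have \<xi>'c: "\<And>j. j < r \<Longrightarrow> \<xi>' j \<in> carrier_vec m" using that by (simp add: is_decomp_def)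
    have "(\<lambda>v. veronese m k r (\<lambda>j. conjugate (\<xi>' j)) *\<^sub>v v) ` carrier_vec r =
        (\<lambda>v. veronese m k r (\<lambda>j. conjugate (\<xi> j)) *\<^sub>v v) ` carrier_vec r"
      using full_hankel_rank(2)[OF T that k(2) rank] full(2) by simp
    from same_veronese_image_match[OF sep k(1) nz this] obtain \<tau> c where
      \<tau>: "bij_betw \<tau> {..<r} {..<r}" and c: "\<And>l. l < r \<Longrightarrow> c l \<noteq> 0"
      and eq: "\<And>l i. l < r \<Longrightarrow> i < m \<Longrightarrow> conjugate (\<xi>' (\<tau> l)) $ i = c l * conjugate (\<xi> l) $ i"
      by metis
    have "line (\<xi>' (\<tau> l)) = line (\<xi> l)" if l: "l < r" for l
    proof (rule line_eq_if_proportional)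
      have \<tau>l: "\<tau> l < r" using \<tau> l by (auto simp: bij_betw_def)
      show "\<xi> l \<in> carrier_vec m" "\<xi>' (\<tau> l) \<in> carrier_vec m" using \<xi>c \<xi>'c l \<tau>l by auto
      show "cnj (c l) \<noteq> 0" using c[OF l] by simp
      show "\<xi>' (\<tau> l) $ i = cnj (c l) * \<xi> l $ i" if "i < m" for i
        using arg_cong[OF eq[OF l that], of cnj] carrier_vecD[OF \<xi>c[OF l]] carrier_vecD[OF \<xi>'c[OF \<tau>l]] that
        by simp
    qed
    then show ?thesis using \<tau> by blast
  qed
  have inj': "inj_on (\<lambda>j. line (\<xi>' j)) {..<r}"
    and img': "(\<lambda>j. line (\<xi>' j)) ` {..<r} = (\<lambda>j. line (\<xi> j)) ` {..<r}"
    if dec': "is_decomp m d T r \<omega>' \<xi>'" for \<omega>' \<xi>'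
  proof -
    obtain \<tau> where \<tau>: "\<tau> ` {..<r} = {..<r}" and l: "\<And>l. l < r \<Longrightarrow> line (\<xi>' (\<tau> l)) = line (\<xi> l)"
      using lines[OF dec'] by (auto simp: bij_betw_def)
    have "inj_on ((\<lambda>j. line (\<xi>' j)) \<circ> \<tau>) {..<r}"
      using inj l by (simp add: inj_on_def)
    from inj_on_imageI[OF this] show "inj_on (\<lambda>j. line (\<xi>' j)) {..<r}" by (simp add: \<tau>)
    have "(\<lambda>j. line (\<xi>' j)) ` {..<r} = (\<lambda>j. line (\<xi>' j)) ` \<tau> ` {..<r}" by (simp add: \<tau>)
    also have "\<dots> = (\<lambda>j. line (\<xi> j)) ` {..<r}"
      unfolding image_image by (rule image_cong) (use l in auto)
    finally show "(\<lambda>j. line (\<xi>' j)) ` {..<r} = (\<lambda>j. line (\<xi> j)) ` {..<r}" .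
  qed
  show ?thesis
    unfolding identifiable_def waring_decomp_def wr
  proof (intro conjI allI impI)
    show "\<exists>\<omega> \<xi>. is_decomp m d T r \<omega> \<xi>" using dec by blast
    fix \<omega>\<^sub>1 \<xi>\<^sub>1 assume 1: "is_decomp m d T r \<omega>\<^sub>1 \<xi>\<^sub>1"
    show "inj_on (\<lambda>j. line (\<xi>\<^sub>1 j)) {..<r}" by (rule inj'[OF 1])
    fix \<omega>\<^sub>2 \<xi>\<^sub>2 assume 2: "is_decomp m d T r \<omega>\<^sub>2 \<xi>\<^sub>2"
    show "(\<lambda>j. line (\<xi>\<^sub>1 j)) ` {..<r} = (\<lambda>j. line (\<xi>\<^sub>2 j)) ` {..<r}"
      using img'[OF 1] img'[OF 2] by simp
  qed
qed

section \<open>Simultaneous diagonalisation\<close>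

text \<open>
  Since \<open>U\<^sub>i = V D\<^sub>i G\<close> with \<open>V\<close> injective and independent of \<open>i\<close>, it suffices to bring \<open>V\<close> to
  the form \<open>[I; 0]\<close> from the left and to cancel \<open>G\<close> from the right.
\<close>

lemma shifted_blocks_diagonalisable:
  assumes sep: "separates m (k - 1) r x" and k: "k \<ge> 1"
    and G: "G \<in> carrier_mat r r" "G' \<in> carrier_mat r r" "G * G' = 1\<^sub>m r" "G' * G = 1\<^sub>m r"
  shows "\<exists>E F. E \<in> carrier_mat (num_monomials m (k - 1)) (num_monomials m (k - 1))
          \<and> F \<in> carrier_mat r r \<and> invertible_mat E \<and> invertible_mat F
          \<and> (\<forall>i<m. E\<^sup>T * shift_submat m k (veronese m k r x * G) i * F
                = pad_rows (num_monomials m (k - 1)) (mat_diag r (\<lambda>j. x j $ i)))"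
proof -
  let ?n = "num_monomials m (k - 1)" and ?V = "veronese m (k - 1) r x"
  note V = veronese_carrier[of m "k - 1" r x]
  have inj: "injective_mat ?V" using sep injective_veronese_iff by blast
  have rn: "r \<le> ?n" by (rule injective_mat_normal_form(1)[OF V inj])
  obtain P Q where P: "P \<in> carrier_mat ?n ?n" "Q \<in> carrier_mat ?n ?n" "P * Q = 1\<^sub>m ?n" "Q * P = 1\<^sub>m ?n"
    "P * ?V = pad_rows ?n (1\<^sub>m r)"
    using injective_mat_normal_form(2)[OF V inj] by blast
  have "invertible_mat P\<^sup>T"
    unfolding invertible_mat_def inverts_mat_def
  proof (intro conjI exI[of _ "Q\<^sup>T"])
    show "P\<^sup>T * Q\<^sup>T = 1\<^sub>m (dim_row P\<^sup>T)" "Q\<^sup>T * P\<^sup>T = 1\<^sub>m (dim_row Q\<^sup>T)"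
      using P(1,2) by (simp_all flip: transpose_mult[OF P(2,1)] transpose_mult[OF P(1,2)] add: P(3,4))
  qed (use P in auto)
  moreover have "invertible_mat G'"
    unfolding invertible_mat_def inverts_mat_def using G by auto
  moreover have "(P\<^sup>T)\<^sup>T * shift_submat m k (veronese m k r x * G) i * G'
      = pad_rows ?n (mat_diag r (\<lambda>j. x j $ i))" if i: "i < m" for i
  proof -
    let ?D = "mat_diag r (\<lambda>j. x j $ i)"
    have D: "?D \<in> carrier_mat r r" by simp
    have DG: "?D * G \<in> carrier_mat r r" by (rule mult_carrier_mat[OF D G(1)])
    have PVD: "P * ?V * ?D \<in> carrier_mat ?n r"
      by (rule mult_carrier_mat[OF mult_carrier_mat[OF P(1) V] D])
    note padD = pad_rows_carrier[OF D rn] and pad1 = pad_rows_carrier[OF one_carrier_mat[of r] rn]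
    have "P * (?V * (?D * G)) * G' = P * ?V * (?D * G) * G'"
      using assoc_mult_mat[OF P(1) V DG] by simp
    also have "\<dots> = P * ?V * (?D * G * G')"
      by (rule assoc_mult_mat[OF mult_carrier_mat[OF P(1) V] DG G(2)])
    also have "?D * G * G' = ?D * (G * G')" by (rule assoc_mult_mat[OF D G(1,2)])
    also have "\<dots> = ?D" using G(3) right_mult_one_mat[OF D] by simp
    also have "P * ?V * ?D = pad_rows ?n ?D"
    proof (rule eq_matI)
      fix a j assume "a < dim_row (pad_rows ?n ?D)" "j < dim_col (pad_rows ?n ?D)"
      then have aj: "a < ?n" "j < r" using padD by auto
      show "(P * ?V * ?D) $$ (a, j) = pad_rows ?n ?D $$ (a, j)"
        unfolding P(5) mat_diag_mult_right[OF pad1] pad_rows_index[OF D rn aj]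
        using aj pad_rows_index[OF one_carrier_mat[of r] rn aj] by (auto simp: mat_diag_def)
    qed (simp_all only: carrier_matD[OF PVD] carrier_matD[OF padD])
    finally show ?thesis unfolding shift_submat_veronese[OF G(1) i k] transpose_transpose .
  qed
  ultimately show ?thesis using P(1) G(2) by (intro exI[of _ "P\<^sup>T"] exI[of _ G']) auto
qed

text \<open>
  With \<open>B = G F\<close> and \<open>Q\<close> the inverse of \<open>E\<^sup>T\<close>, the hypothesis reads \<open>V D\<^sub>i B = Q [\<Delta>\<^sub>i; 0]\<close>: in
  column \<open>j\<close> all these matrices are multiples of the \<open>j\<close>-th column of \<open>Q\<close>, by the \<open>j\<close>-th diagonal
  entry of \<open>\<Delta>\<^sub>i\<close>.  This is the situation of \<open>matching_points\<close>.
\<close>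

lemma diagonalisation_recovers_points:
  assumes sep: "separates m (k - 1) r x" and k: "k \<ge> 1"
    and nz: "\<And>l. l < r \<Longrightarrow> \<exists>i<m. x l $ i \<noteq> 0"
    and G: "G \<in> carrier_mat r r" "G' \<in> carrier_mat r r" "G * G' = 1\<^sub>m r"
    and E: "E \<in> carrier_mat (num_monomials m (k - 1)) (num_monomials m (k - 1))" "invertible_mat E"
    and F: "F \<in> carrier_mat r r" "invertible_mat F"
    and \<Delta>: "\<And>i. i < m \<Longrightarrow> \<Delta> i \<in> carrier_mat r r" "\<And>i. i < m \<Longrightarrow> diagonal_mat (\<Delta> i)"
    and diag: "\<And>i. i < m \<Longrightarrow> E\<^sup>T * shift_submat m k (veronese m k r x * G) i * F
        = pad_rows (num_monomials m (k - 1)) (\<Delta> i)"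
  obtains \<tau> c where "bij_betw \<tau> {..<r} {..<r}"
    and "\<And>l. l < r \<Longrightarrow> c l \<noteq> 0" and "\<And>l i. l < r \<Longrightarrow> i < m \<Longrightarrow> \<Delta> i $$ (\<tau> l, \<tau> l) = c l * x l $ i"
proof -
  let ?n = "num_monomials m (k - 1)" and ?V = "veronese m (k - 1) r x"
  note V = veronese_carrier[of m "k - 1" r x]
  have rn: "r \<le> ?n" using injective_mat_normal_form(1)[OF V] sep injective_veronese_iff by blast
  obtain E' where E': "E * E' = 1\<^sub>m ?n" "E' * E = 1\<^sub>m (dim_row E')"
    using E unfolding invertible_mat_def inverts_mat_def by auto
  have E'c: "E' \<in> carrier_mat ?n ?n"
    using E'(1) E'(2) E(1) by (metis carrier_matD(2) carrier_matI index_mult_mat(2,3) index_one_mat(2,3))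
  define Q where "Q = E'\<^sup>T"
  have Q: "Q \<in> carrier_mat ?n ?n" "Q * E\<^sup>T = 1\<^sub>m ?n"
    using E'c transpose_mult[OF E(1) E'c] E'(1) unfolding Q_def by auto
  obtain F' where F': "F * F' = 1\<^sub>m r" "F' * F = 1\<^sub>m (dim_row F')"
    using F unfolding invertible_mat_def inverts_mat_def by auto
  have F'c: "F' \<in> carrier_mat r r"
    using F'(1) F'(2) F(1) by (metis carrier_matD(2) carrier_matI index_mult_mat(2,3) index_one_mat(2,3))
  define B where "B = G * F"
  have B: "B \<in> carrier_mat r r" unfolding B_def using G F by simp
  have "B * (F' * G') = G * (F * (F' * G'))"
    unfolding B_def using F'c G F by (intro assoc_mult_mat) auto
  also have "F * (F' * G') = F * F' * G'"
    using F'c G F by (intro assoc_mult_mat[symmetric]) auto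
  also have "G * (F * F' * G') = 1\<^sub>m r" using F' G by simp
  finally have BB': "B * (F' * G') = 1\<^sub>m r" .
  have VDB: "?V * (mat_diag r (\<lambda>l. x l $ i) * B) = Q * pad_rows ?n (\<Delta> i)" if i: "i < m" for i
  proof -
    let ?D = "mat_diag r (\<lambda>l. x l $ i)"
    have D: "?D \<in> carrier_mat r r" by simp
    have DG: "?D * G \<in> carrier_mat r r" by (rule mult_carrier_mat[OF D G(1)])
    let ?S = "?V * (?D * G)"
    have S: "?S \<in> carrier_mat ?n r" by (rule mult_carrier_mat[OF V DG])
    have SF: "?S * F \<in> carrier_mat ?n r" by (rule mult_carrier_mat[OF S F(1)])
    have ET: "E\<^sup>T \<in> carrier_mat ?n ?n" using E(1) by simp
    have "Q * pad_rows ?n (\<Delta> i) = Q * (E\<^sup>T * ?S * F)"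
      using diag[OF i] unfolding shift_submat_veronese[OF G(1) i k] by simp
    also have "E\<^sup>T * ?S * F = E\<^sup>T * (?S * F)" by (rule assoc_mult_mat[OF ET S F(1)])
    also have "Q * (E\<^sup>T * (?S * F)) = Q * E\<^sup>T * (?S * F)"
      by (rule assoc_mult_mat[OF Q(1) ET SF, symmetric])
    also have "\<dots> = ?S * F" unfolding Q(2) by (rule left_mult_one_mat[OF SF])
    also have "\<dots> = ?V * (?D * G * F)" by (rule assoc_mult_mat[OF V DG F(1)])
    also have "?D * G * F = ?D * B" unfolding B_def by (rule assoc_mult_mat[OF D G(1) F(1)])
    finally show ?thesis by simp
  qed
  show thesis
  proof (rule matching_points[OF sep nz, of "\<lambda>l j. B $$ (l, j)"
        "\<lambda>j. vec m (\<lambda>i. \<Delta> i $$ (j, j))" "\<lambda>j \<alpha>. Q $$ (mon_index m (k - 1) \<alpha>, j)"])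
    show "\<exists>j<r. B $$ (l, j) \<noteq> 0" if "l < r" for l
      by (rule right_invertible_row_nonzero[OF B _ BB' that]) (use F'c G in auto)
    show "(\<Sum>l<r. B $$ (l, j) * x l $ i * monomial_at m (x l) \<alpha>)
        = vec m (\<lambda>i. \<Delta> i $$ (j, j)) $ i * Q $$ (mon_index m (k - 1) \<alpha>, j)"
      if j: "j < r" and i: "i < m" and \<alpha>: "\<alpha> \<in> monomials m (k - 1)" for j i \<alpha>
    proof -
      let ?a = "mon_index m (k - 1) \<alpha>"
      have a: "?a < ?n" by (rule mon_index(1)[OF \<alpha>])
      have DB: "mat_diag r (\<lambda>l. x l $ i) * B \<in> carrier_mat r r"
        using B by (auto intro: mult_carrier_mat[OF mat_diag_dim])
      note pad = pad_rows_carrier[OF \<Delta>(1)[OF i] rn]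
      have "(\<Sum>l<r. B $$ (l, j) * x l $ i * monomial_at m (x l) \<alpha>) =
          (?V * (mat_diag r (\<lambda>l. x l $ i) * B)) $$ (?a, j)"
        unfolding veronese_mult_index[OF DB \<alpha> j]
        by (rule sum.cong) (use j in \<open>auto simp: mat_diag_mult_left[OF B] mult_ac\<close>)
      also have "\<dots> = (Q * pad_rows ?n (\<Delta> i)) $$ (?a, j)" by (simp only: VDB[OF i])
      also have "\<dots> = (\<Sum>b<?n. Q $$ (?a, b) * pad_rows ?n (\<Delta> i) $$ (b, j))"
        using a j pad Q(1) by (simp add: scalar_prod_def atLeast0LessThan)
      also have "\<dots> = (\<Sum>b<?n. if b = j then Q $$ (?a, j) * \<Delta> i $$ (j, j) else 0)"
      proof (rule sum.cong)
        fix b assume "b \<in> {..<?n}"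
        then have b: "b < ?n" by simp
        show "Q $$ (?a, b) * pad_rows ?n (\<Delta> i) $$ (b, j) =
            (if b = j then Q $$ (?a, j) * \<Delta> i $$ (j, j) else 0)"
          using \<Delta>[OF i] j pad_rows_index[OF \<Delta>(1)[OF i] rn b j] by (auto simp: diagonal_mat_def)
      qed simp
      also have "\<dots> = \<Delta> i $$ (j, j) * Q $$ (?a, j)" using j rn by simp
      finally show ?thesis using i by simp
    qed
    fix \<tau> c assume "bij_betw \<tau> {..<r} {..<r}" "\<And>l. l < r \<Longrightarrow> c l \<noteq> 0"
      and "\<And>l i. l < r \<Longrightarrow> i < m \<Longrightarrow> vec m (\<lambda>i. \<Delta> i $$ (\<tau> l, \<tau> l)) $ i = c l * x l $ i"
    then show thesis using that[of \<tau> c] by simp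
  qed
qed

theorem theorem3p6:
  fixes m d k r :: nat
    and T :: cpoly
    and \<omega> :: "nat \<Rightarrow> complex"
    and \<xi> :: "nat \<Rightarrow> complex vec"
    and U :: "complex mat"
  assumes "T \<in> homog m d"
    and "is_decomp m d T r \<omega> \<xi>"
    and "\<exists>l u. interp_family m l r \<xi> u"
    and "interp_degree m r \<xi> + 1 \<le> k" and "k \<le> d"
    and "hankel_rank m d k T = r"
    and "U \<in> carrier_mat (num_monomials m k) r"
    and "(\<lambda>v. U *\<^sub>v v) ` carrier_vec r = hankel m d k T ` homog m (d - k)"
  shows "waring_rank m d T = r \<and> identifiable m d T
    \<and> (\<exists>E F. E \<in> carrier_mat (num_monomials m (k - 1)) (num_monomials m (k - 1))
          \<and> F \<in> carrier_mat r r \<and> invertible_mat E \<and> invertible_mat F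
          \<and> (\<forall>i<m. E\<^sup>T * shift_submat m k U i * F
                = pad_rows (num_monomials m (k - 1)) (mat_diag r (\<lambda>j. cnj (\<xi> j $ i)))))
    \<and> (\<forall>E F \<Delta>. E \<in> carrier_mat (num_monomials m (k - 1)) (num_monomials m (k - 1))
          \<and> F \<in> carrier_mat r r \<and> invertible_mat E \<and> invertible_mat F
          \<and> (\<forall>i<m. \<Delta> i \<in> carrier_mat r r \<and> diagonal_mat (\<Delta> i)
                \<and> E\<^sup>T * shift_submat m k U i * F = pad_rows (num_monomials m (k - 1)) (\<Delta> i))
        \<longrightarrow> (\<exists>!\<omega>'. \<omega>' \<in> carrier_vec r
              \<and> is_decomp m d T r (\<lambda>j. \<omega>' $ j) (\<lambda>j. vec m (\<lambda>i. cnj (\<Delta> i $$ (j, j))))))"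
proof -
  let ?n = "num_monomials m (k - 1)"
  define x where "x = (\<lambda>j. conjugate (\<xi> j))"
  note T = assms(1) and dec = assms(2) and kd = assms(5) and rank = assms(6)
  have k: "1 \<le> k" using assms(4) by simp
  have \<xi>c: "\<And>j. j < r \<Longrightarrow> \<xi> j \<in> carrier_vec m" using dec by (simp add: is_decomp_def)
  have xi: "x j $ i = cnj (\<xi> j $ i)" if "j < r" "i < m" for i j
    unfolding x_def using \<xi>c[OF that(1)] that(2) by simp
  note full = full_hankel_rank[OF T dec kd rank, folded x_def]
  have nz: "\<exists>i<m. x l $ i \<noteq> 0" if "l < r" for l
    using separates_nonzero[OF full(1) k that] .
  have nz\<xi>: "\<exists>i<m. \<xi> l $ i \<noteq> 0" if "l < r" for l
    using nz[OF that] xi[OF that] by auto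
  \<comment> \<open>Degree \<open>k - 1\<close> is at least the interpolation degree, so separation climbs to \<open>k - 1\<close> and to \<open>d\<close>;
    the climb needs nonzero points, which the Hankel rank provides.\<close>
  obtain u where "interp_family m (interp_degree m r \<xi>) r \<xi> u"
    using LeastI_ex[OF assms(3)] unfolding interp_degree_def by blast
  from interp_family_separates[OF this] have sep\<xi>: "separates m (interp_degree m r \<xi>) r \<xi>" .
  have sepd: "separates m d r \<xi>"
    using assms(4,5) by (intro separates_mono[OF sep\<xi> _ nz\<xi>]) auto
  have "separates m (k - 1) r \<xi>"
    using assms(4) by (intro separates_mono[OF sep\<xi> _ nz\<xi>]) auto
  then have sep: "separates m (k - 1) r x"
    unfolding x_def by (rule separates_conjugate) (rule \<xi>c)
  have "injective_mat (veronese m k r x)" using full(1) injective_veronese_iff by blast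
  from same_image_factor[OF veronese_carrier assms(7) this] obtain G G' where
    G: "G \<in> carrier_mat r r" "G' \<in> carrier_mat r r" "G * G' = 1\<^sub>m r" "G' * G = 1\<^sub>m r"
    and U: "U = veronese m k r x * G"
    using assms(8) full(2) by metis
  have diag: "mat_diag r (\<lambda>j. cnj (\<xi> j $ i)) = mat_diag r (\<lambda>j. x j $ i)" if "i < m" for i
    by (rule eq_matI) (auto simp: mat_diag_def xi that)
  have ex: "\<exists>E F. E \<in> carrier_mat ?n ?n
          \<and> F \<in> carrier_mat r r \<and> invertible_mat E \<and> invertible_mat F
          \<and> (\<forall>i<m. E\<^sup>T * shift_submat m k U i * F = pad_rows ?n (mat_diag r (\<lambda>j. cnj (\<xi> j $ i))))"
    using shifted_blocks_diagonalisable[OF sep k G] diag unfolding U by simp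
  have uniq: "\<exists>!\<omega>'. \<omega>' \<in> carrier_vec r
        \<and> is_decomp m d T r (\<lambda>j. \<omega>' $ j) (\<lambda>j. vec m (\<lambda>i. cnj (\<Delta> i $$ (j, j))))"
    if E: "E \<in> carrier_mat ?n ?n" "invertible_mat E" and F: "F \<in> carrier_mat r r" "invertible_mat F"
      and \<Delta>: "\<forall>i<m. \<Delta> i \<in> carrier_mat r r \<and> diagonal_mat (\<Delta> i)
                \<and> E\<^sup>T * shift_submat m k U i * F = pad_rows ?n (\<Delta> i)" for E F \<Delta>
  proof -
    obtain \<tau> c where \<tau>: "bij_betw \<tau> {..<r} {..<r}" and c: "\<And>l. l < r \<Longrightarrow> c l \<noteq> 0"
      and eq: "\<And>l i. l < r \<Longrightarrow> i < m \<Longrightarrow> \<Delta> i $$ (\<tau> l, \<tau> l) = c l * x l $ i"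
      by (rule diagonalisation_recovers_points[OF sep k nz G(1,2,3) E F, of \<Delta>])
        (use \<Delta> in \<open>auto simp: U\<close>)
    show ?thesis
      by (rule rescaled_points_unique_weights[OF T dec sepd \<tau>, of "\<lambda>l. cnj (c l)"])
        (auto simp: c eq xi)
  qed
  show ?thesis
    using waring_rank_eq_hankel_rank[OF T dec k kd rank]
      identifiable_if_full_hankel_rank[OF T dec k kd rank sep[unfolded x_def]] ex uniq
    by (intro conjI allI impI) blast+
qed

end
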